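(* Let $n\in\mathbb N$, let $\varphi:T_\Omega\to T_\Omega$ be holomorphic and $\psi\in H(T_\Omega)$, and suppose that $W_{\psi,\varphi}$ is a bounded weighted composition operator on $H^n_{2,\rho}(T_\Omega)$. Then $$|\psi(w)|^2\,K^{(n,\rho)}(\varphi(w),\varphi(w))\le\|W_{\psi,\varphi}\|^2\,K^{(n,\rho)}(w,w)$$ for every $w\in T_\Omega$.
   Context: Let $d\ge 1$ and let $\Omega\subset\mathbb R^d$ be a nonempty open convex cone containing no complete straight line. Its dual cone is $\Omega^\ast=\{\xi\in\mathbb R^d:\langle x,\xi\rangle\ge 0\text{ for all }x\in\Omega\}$, and $T_\Omega=\mathbb R^d+i\Omega\subset\mathbb C^d$ is the associated tube domain; $H(T_\Omega)$ is the space of holomorphic functions on $T_\Omega$. For $z\in\mathbb C^d$, $\xi\in\mathbb R^d$, $\langle z,\xi\rangle=\sum_{j=1}^d z_j\xi_j$ (bilinear). Fix a continuous function $\rho:\Omega^\ast\to[0,\infty)$ with $\rho(\xi)>0$ for $\xi\ne 0$ and $\rho(t\xi)=t\rho(\xi)$ for all $t>0$, $\xi\in\Omega^\ast$ (so $\rho(0)=0$). For $n\in\mathbb N$ let $w_n(\xi)=\sum_{k=0}^n\rho(\xi)^{2k}$, and let $L^2(\Omega^\ast,w_n)$ be the space of (classes of) measurable complex functions $f$ on $\Omega^\ast$ with $\|f\|_{L^2(\Omega^\ast,w_n)}^2=\int_{\Omega^\ast}|f|^2w_n\,d\xi<\infty$. The Hilbertian Hardy--Sobolev space $H^n_{2,\rho}(T_\Omega)$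 consists of all holomorphic functions on $T_\Omega$ of the form $\mathcal Lf(z)=\int_{\Omega^\ast}e^{i\langle z,\xi\rangle}f(\xi)\,d\xi$ with $f\in L^2(\Omega^\ast,w_n)$. The map $\mathcal L$ is injective on $L^2(\Omega^\ast,w_n)$, and $H^n_{2,\rho}(T_\Omega)$ is a Hilbert space with inner product $\langle\mathcal Lf,\mathcal Lg\rangle=\int_{\Omega^\ast}f\overline g\,w_n\,d\xi$. Point evaluations at points of $T_\Omega$ are bounded on it. For $w\in T_\Omega$, $K^{(n,\rho)}_w\in H^n_{2,\rho}(T_\Omega)$ denotes the unique function with $F(w)=\langle F,K^{(n,\rho)}_w\rangle$ for all $F\in H^n_{2,\rho}(T_\Omega)$, and $K^{(n,\rho)}(z,w):=K^{(n,\rho)}_w(z)$. The weighted composition operator is $W_{\psi,\varphi}F=\psi\cdot(F\circ\varphi)$. It is a bounded weighted composition operator on $H^n_{2,\rho}(T_\Omega)$ if $W_{\psi,\varphi}F\in H^n_{2,\rho}(T_\Omega)$ for all $F\in H^n_{2,\rho}(T_\Omega)$ and the resulting linear operator is bounded; $\|W_{\psi,\varphi}\|$ is its operator norm. *)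

theory Defs
  imports "HOL-Analysis.Analysis" "HOL-Library.Complex_Order"
begin

text \<open>
  Points of \<open>\<complex>\<^sup>d\<close> and \<open>\<real>\<^sup>d\<close> are vectors indexed by a finite type \<open>'d\<close>, so \<open>d = CARD('d) \<ge> 1\<close>.
  Functions on a tube domain are represented by HOL functions that are \<open>undefined\<close> outside of it
  (\<^const>\<open>extensional\<close>), so that HOL equality is equality as functions on the tube domain.
\<close>

text \<open>
  The library's \<^const>\<open>cone\<close> and \<^const>\<open>convex_cone\<close> force the apex into the set, which is wrong for
  open cones; here only positive multiples are required.
\<close>

definition open_convex_cone :: "(real ^ 'd) set \<Rightarrow> bool" where
  "open_convex_cone \<Omega> \<longleftrightarrow> open \<Omega> \<and> convex \<Omega> \<and> (\<forall>x\<in>\<Omega>. \<forall>t>0. t *\<^sub>R x \<in> \<Omega>)"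

definition contains_line :: "(real ^ 'd) set \<Rightarrow> bool" where
  "contains_line S \<longleftrightarrow> (\<exists>a v. v \<noteq> 0 \<and> (\<forall>t. a + t *\<^sub>R v \<in> S))"

definition dual_cone :: "(real ^ 'd) set \<Rightarrow> (real ^ 'd) set" where
  "dual_cone \<Omega> = {\<xi>. \<forall>x\<in>\<Omega>. x \<bullet> \<xi> \<ge> 0}"

definition tube :: "(real ^ 'd) set \<Rightarrow> (complex ^ 'd) set" where
  "tube \<Omega> = {z. (\<chi> j. Im (z $ j)) \<in> \<Omega>}"

text \<open>Holomorphy in several variables: complex-linear total derivative at every point
  (intended for open \<open>S\<close>).\<close>

definition holomorphic_cn_on :: "(complex ^ 'd \<Rightarrow> complex) \<Rightarrow> (complex ^ 'd) set \<Rightarrow> bool" where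
  "holomorphic_cn_on F S \<longleftrightarrow>
     (\<forall>z\<in>S. \<exists>a. (F has_derivative (\<lambda>h. \<Sum>j\<in>UNIV. a $ j * h $ j)) (at z))"

definition bilin :: "complex ^ 'd \<Rightarrow> real ^ 'd \<Rightarrow> complex" where
  "bilin z \<xi> = (\<Sum>j\<in>UNIV. z $ j * complex_of_real (\<xi> $ j))"

definition sobolev_weight :: "(real ^ 'd \<Rightarrow> real) \<Rightarrow> nat \<Rightarrow> real ^ 'd \<Rightarrow> real" where
  "sobolev_weight \<rho> n \<xi> = (\<Sum>k=0..n. \<rho> \<xi> ^ (2 * k))"

text \<open>Elements are functions rather than classes modulo null sets; the notions below
  do not depend on the representative.\<close>

definition weighted_L2 ::
  "(real ^ 'd) set \<Rightarrow> (real ^ 'd \<Rightarrow> real) \<Rightarrow> nat \<Rightarrow> (real ^ 'd \<Rightarrow> complex) set" where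
  "weighted_L2 \<Omega> \<rho> n =
     {f \<in> borel_measurable (lebesgue_on (dual_cone \<Omega>)).
        integrable (lebesgue_on (dual_cone \<Omega>)) (\<lambda>\<xi>. (cmod (f \<xi>))\<^sup>2 * sobolev_weight \<rho> n \<xi>)}"

definition laplace :: "(real ^ 'd) set \<Rightarrow> (real ^ 'd \<Rightarrow> complex) \<Rightarrow> complex ^ 'd \<Rightarrow> complex" where
  "laplace \<Omega> f =
     (\<lambda>z\<in>tube \<Omega>. \<integral>\<xi>. exp (\<i> * bilin z \<xi>) * f \<xi> \<partial>(lebesgue_on (dual_cone \<Omega>)))"

definition hardy_sobolev ::
  "(real ^ 'd) set \<Rightarrow> (real ^ 'd \<Rightarrow> real) \<Rightarrow> nat \<Rightarrow> (complex ^ 'd \<Rightarrow> complex) set" where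
  "hardy_sobolev \<Omega> \<rho> n =
     {F. holomorphic_cn_on F (tube \<Omega>) \<and> (\<exists>f\<in>weighted_L2 \<Omega> \<rho> n. F = laplace \<Omega> f)}"

text \<open>The preimage of \<open>F\<close> under the Laplace transform. By injectivity of the transform it is
  determined up to a null set, and the choice of representative does not affect the inner product.\<close>

definition inv_laplace ::
  "(real ^ 'd) set \<Rightarrow> (real ^ 'd \<Rightarrow> real) \<Rightarrow> nat \<Rightarrow> (complex ^ 'd \<Rightarrow> complex) \<Rightarrow> real ^ 'd \<Rightarrow> complex"
  where "inv_laplace \<Omega> \<rho> n F = (SOME f. f \<in> weighted_L2 \<Omega> \<rho> n \<and> F = laplace \<Omega> f)"

definition hs_inner ::
  "(real ^ 'd) set \<Rightarrow> (real ^ 'd \<Rightarrow> real) \<Rightarrow> nat \<Rightarrow>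
     (complex ^ 'd \<Rightarrow> complex) \<Rightarrow> (complex ^ 'd \<Rightarrow> complex) \<Rightarrow> complex" where
  "hs_inner \<Omega> \<rho> n F G =
     (\<integral>\<xi>. inv_laplace \<Omega> \<rho> n F \<xi> * cnj (inv_laplace \<Omega> \<rho> n G \<xi>)
            * complex_of_real (sobolev_weight \<rho> n \<xi>) \<partial>(lebesgue_on (dual_cone \<Omega>)))"

definition hs_norm ::
  "(real ^ 'd) set \<Rightarrow> (real ^ 'd \<Rightarrow> real) \<Rightarrow> nat \<Rightarrow> (complex ^ 'd \<Rightarrow> complex) \<Rightarrow> real" where
  "hs_norm \<Omega> \<rho> n F = sqrt (Re (hs_inner \<Omega> \<rho> n F F))"

definition hs_kernel ::
  "(real ^ 'd) set \<Rightarrow> (real ^ 'd \<Rightarrow> real) \<Rightarrow> nat \<Rightarrow> complex ^ 'd \<Rightarrow> complex ^ 'd \<Rightarrow> complex" where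
  "hs_kernel \<Omega> \<rho> n z w =
     (THE k. k \<in> hardy_sobolev \<Omega> \<rho> n \<and>
        (\<forall>F\<in>hardy_sobolev \<Omega> \<rho> n. F w = hs_inner \<Omega> \<rho> n F k)) z"

definition weighted_comp ::
  "(real ^ 'd) set \<Rightarrow> (complex ^ 'd \<Rightarrow> complex) \<Rightarrow> (complex ^ 'd \<Rightarrow> complex ^ 'd) \<Rightarrow>
     (complex ^ 'd \<Rightarrow> complex) \<Rightarrow> complex ^ 'd \<Rightarrow> complex" where
  "weighted_comp \<Omega> \<psi> \<phi> F = (\<lambda>z\<in>tube \<Omega>. \<psi> z * F (\<phi> z))"

definition hs_bounded_op ::
  "(real ^ 'd) set \<Rightarrow> (real ^ 'd \<Rightarrow> real) \<Rightarrow> nat \<Rightarrow>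
     ((complex ^ 'd \<Rightarrow> complex) \<Rightarrow> complex ^ 'd \<Rightarrow> complex) \<Rightarrow> bool" where
  "hs_bounded_op \<Omega> \<rho> n A \<longleftrightarrow>
     (\<forall>F\<in>hardy_sobolev \<Omega> \<rho> n. A F \<in> hardy_sobolev \<Omega> \<rho> n) \<and>
     (\<exists>C. \<forall>F\<in>hardy_sobolev \<Omega> \<rho> n. hs_norm \<Omega> \<rho> n (A F) \<le> C * hs_norm \<Omega> \<rho> n F)"

definition hs_onorm ::
  "(real ^ 'd) set \<Rightarrow> (real ^ 'd \<Rightarrow> real) \<Rightarrow> nat \<Rightarrow>
     ((complex ^ 'd \<Rightarrow> complex) \<Rightarrow> complex ^ 'd \<Rightarrow> complex) \<Rightarrow> real" where
  "hs_onorm \<Omega> \<rho> n A =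
     Sup {hs_norm \<Omega> \<rho> n (A F) | F. F \<in> hardy_sobolev \<Omega> \<rho> n \<and> hs_norm \<Omega> \<rho> n F \<le> 1}"

end

theory Submission
  imports Defs
begin

text \<open>
  Write \<open>k\<^sub>w\<close> for the reproducing kernel function at \<open>w\<close>, so that \<open>K(w,w) = \<parallel>k\<^sub>w\<parallel>\<^sup>2\<close>. Applying the operator
  \<open>W\<close> to \<open>k\<^bsub>\<phi>(w)\<^esub>\<close>, evaluating at \<open>w\<close> and using the Cauchy--Schwarz inequality gives
  \<open>\<bar>\<psi>(w)\<bar> K(\<phi>(w),\<phi>(w)) = \<bar>(W k\<^bsub>\<phi>(w)\<^esub>)(w)\<bar> = \<bar>\<langle>W k\<^bsub>\<phi>(w)\<^esub>, k\<^sub>w\<rangle>\<bar> \<le> \<parallel>W\<parallel> \<parallel>k\<^bsub>\<phi>(w)\<^esub>\<parallel> \<parallel>k\<^sub>w\<parallel>\<close>.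
  Dividing by \<open>\<parallel>k\<^bsub>\<phi>(w)\<^esub>\<parallel>\<close> and squaring is the claim; if that norm is zero, so is the left-hand side.
  
  The substance lies in showing that the kernel exists and that the inner product means what it should.
  The inner product of two functions is an integral of chosen preimages under the Laplace transform, so
  it is only meaningful because the transform is injective modulo null sets (\<open>laplace_injective\<close>). Already
  the real Laplace transform, at the points \<open>i u\<close> with \<open>u \<in> \<Omega>\<close>, is enough for that. Finitely many
  exponentials \<open>exp (- u \<bullet> \<xi>)\<close> embed the dual cone in a compact cube, and because \<open>\<Omega>\<close> is closed under
  addition, vanishing of the transform says that all moments of the transported complex measure vanish;
  by the Stone--Weierstrass theorem the measure is zero (\<open>exp_moments_zero_imp_AE_zero\<close>).
  
  The kernel function at \<open>w\<close> is the transform of \<open>exp (i \<langle>w,\<xi>\<rangle>)\<^sup>* / w\<^sub>n(\<xi>)\<close>, where the star is complex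
  conjugation. It is in \<open>L\<^sup>2\<close> because
  \<open>y \<bullet> \<xi> \<ge> c \<parallel>\<xi>\<parallel>\<close> on the dual cone for every \<open>y\<close> in the open cone \<open>\<Omega>\<close> (\<open>dual_cone_exp_bound\<close>), and the same
  exponential decay lets one differentiate under the integral sign, so that all transforms are
  holomorphic (\<open>laplace_holomorphic\<close>). Uniqueness of the kernel follows from the symmetry of
  the reproducing property alone (\<open>hs_kernel_eq_kernel_fun\<close>).
\<close>

section \<open>Integrability of exponentials of the norm\<close>

lemma nn_integral_exp_neg_abs_finite:
  assumes "0 < (c::real)"
  shows "(\<integral>\<^sup>+x. ennreal (exp (- c * \<bar>x\<bar>)) \<partial>lborel) < \<infinity>"
proof -
  have half: "(\<integral>\<^sup>+x. ennreal (exp (- c * x)) * indicator {0..} x \<partial>lborel) = ennreal (0 - (- exp (- c * 0) / c))"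
  proof (rule nn_integral_FTC_atLeast)
    have "((\<lambda>x. exp (- (c * x))) \<longlongrightarrow> 0) at_top"
      using assms
      by (intro filterlim_compose[OF exp_at_bot] filterlim_compose[OF filterlim_uminus_at_bot_at_top]
            filterlim_tendsto_pos_mult_at_top[OF tendsto_const] filterlim_ident) auto
    then show "((\<lambda>x. - exp (- c * x) / c) \<longlongrightarrow> 0) at_top"
      using tendsto_divide[OF tendsto_minus tendsto_const, of "\<lambda>x. exp (- (c * x))" 0 at_top c] assms by simp
    show "DERIV (\<lambda>x. - exp (- c * x) / c) x :> exp (- c * x)" for x
      using assms by (auto intro!: derivative_eq_intros)
  qed auto
  have reflect: "(\<integral>\<^sup>+x. ennreal (exp (- c * x)) * indicator {0..} x \<partial>lborel)
      = (\<integral>\<^sup>+x. ennreal (exp (c * x)) * indicator {0..} (-x) \<partial>lborel)"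
    by (subst nn_integral_real_affine[where c="-1" and t=0]) auto
  have "(\<integral>\<^sup>+x. ennreal (exp (- c * \<bar>x\<bar>)) \<partial>lborel) \<le>
     (\<integral>\<^sup>+x. ennreal (exp (- c * x)) * indicator {0..} x + ennreal (exp (c * x)) * indicator {0..} (-x) \<partial>lborel)"
    by (intro nn_integral_mono) (auto simp: indicator_def)
  also have "\<dots> = (\<integral>\<^sup>+x. ennreal (exp (- c * x)) * indicator {0..} x \<partial>lborel)
     + (\<integral>\<^sup>+x. ennreal (exp (c * x)) * indicator {0..} (-x) \<partial>lborel)"
    by (rule nn_integral_add) auto
  also have "\<dots> < \<infinity>"
    using half by (simp add: reflect[symmetric] del: mult_minus_left)
  finally show ?thesis .
qed

text \<open>
  The norm dominates the average of the absolute values of the coordinates, so the function lies below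
  a product of one-dimensional exponentials.
\<close>

lemma integrable_exp_neg_norm:
  fixes c :: real
  assumes "0 < c"
  shows "integrable lborel (\<lambda>x::'a::euclidean_space. exp (- c * norm x))"
proof (rule integrableI_bounded)
  define k where "k = c / real DIM('a)"
  have k: "0 < k" using assms by (simp add: k_def)
  have "exp (- c * norm x) \<le> (\<Prod>b\<in>Basis. exp (- k * \<bar>x \<bullet> b\<bar>))" for x :: 'a
  proof -
    have "(\<Sum>b\<in>Basis. k * \<bar>x \<bullet> b\<bar>) \<le> (\<Sum>b\<in>(Basis::'a set). k * norm x)"
      using k by (intro sum_mono mult_left_mono Basis_le_norm) auto
    also have "\<dots> = c * norm x" by (simp add: k_def)
    finally show ?thesis by (simp add: exp_sum[symmetric] sum_negf)
  qed
  then have "(\<integral>\<^sup>+x. norm (exp (- c * norm x)) \<partial>(lborel :: 'a measure))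
     \<le> (\<integral>\<^sup>+x. (\<Prod>b\<in>Basis. ennreal (exp (- k * \<bar>x \<bullet> b\<bar>))) \<partial>(lborel :: 'a measure))"
    by (intro nn_integral_mono) (simp add: prod_ennreal ennreal_leI)
  also have "\<dots> = (\<Prod>b\<in>(Basis::'a set). (\<integral>\<^sup>+t. ennreal (exp (- k * \<bar>t\<bar>)) \<partial>lborel))"
    by (rule nn_integral_lborel_prod) auto
  also have "\<dots> < \<infinity>"
    using nn_integral_exp_neg_abs_finite[OF k] by (simp add: power_less_top_ennreal)
  finally show "(\<integral>\<^sup>+x. norm (exp (- c * norm x)) \<partial>(lborel :: 'a measure)) < \<infinity>" .
qed auto

lemma integrable_exp_neg_norm_lebesgue_on:
  assumes "0 < (c::real)" and "S \<in> sets lebesgue"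
  shows "integrable (lebesgue_on S) (\<lambda>x::'a::euclidean_space. exp (- c * norm x))"
proof -
  have "integrable lebesgue (\<lambda>x::'a. exp (- c * norm x))"
    using integrable_exp_neg_norm[OF assms(1)] by (simp add: integrable_completion)
  then show ?thesis
    using assms(2) integrable_mult_indicator[of S lebesgue "\<lambda>x. exp (- c * norm x)"]
    by (simp add: integrable_restrict_space)
qed

section \<open>Dual cones and the bilinear form\<close>

text \<open>
  A whole closed ball of radius \<open>c\<close> around \<open>y\<close> lies in \<open>\<Omega>\<close>; test \<open>\<xi>\<close> against the point of that ball
  lying farthest in the direction \<open>- \<xi>\<close>.
\<close>

lemma dual_cone_exp_bound:
  assumes "open_convex_cone \<Omega>" "y \<in> \<Omega>"
  obtains c where "0 < c" "\<And>\<xi>. \<xi> \<in> dual_cone \<Omega> \<Longrightarrow> c * norm \<xi> \<le> y \<bullet> \<xi>"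
proof -
  have "open \<Omega>" using assms by (simp add: open_convex_cone_def)
  then obtain c where c: "0 < c" "cball y c \<subseteq> \<Omega>"
    using assms(2) open_contains_cball by blast
  have "c * norm \<xi> \<le> y \<bullet> \<xi>" if "\<xi> \<in> dual_cone \<Omega>" for \<xi>
  proof (cases "\<xi> = 0")
    case False
    have "y - (c / norm \<xi>) *\<^sub>R \<xi> \<in> \<Omega>"
      using c False by (intro subsetD[OF c(2)]) (simp add: dist_norm)
    then have "0 \<le> (y - (c / norm \<xi>) *\<^sub>R \<xi>) \<bullet> \<xi>"
      using that by (auto simp: dual_cone_def)
    then show ?thesis
      using False by (simp add: inner_diff_left power2_norm_eq_inner[symmetric] power2_eq_square)
  qed simp
  then show ?thesis using c that by blast
qed

lemma closed_dual_cone: "closed (dual_cone \<Omega>)"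
proof -
  have "dual_cone \<Omega> = (\<Inter>x\<in>\<Omega>. {\<xi>. 0 \<le> x \<bullet> \<xi>})" by (auto simp: dual_cone_def)
  then show ?thesis by (auto intro!: closed_INT closed_Collect_le continuous_intros)
qed

lemma dual_cone_measurable: "dual_cone \<Omega> \<in> sets lebesgue"
  using closed_dual_cone[of \<Omega>] borel_closed by (simp add: sets_completionI_sets)

lemma norm_bilin_le: "norm (bilin z \<xi>) \<le> norm z * norm \<xi>"
proof -
  have "norm (bilin z \<xi>) \<le> (\<Sum>j\<in>UNIV. \<bar>norm (z $ j)\<bar> * \<bar>\<xi> $ j\<bar>)"
    unfolding bilin_def by (rule order_trans[OF norm_sum]) (simp add: norm_mult)
  also have "\<dots> \<le> norm z * norm \<xi>"
    using L2_set_mult_ineq[of "\<lambda>j. norm (z $ j)" "\<lambda>j. \<xi> $ j" UNIV]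
    by (simp add: norm_vec_def L2_set_def)
  finally show ?thesis .
qed

lemma bilin_add: "bilin (z + h) \<xi> = bilin z \<xi> + bilin h \<xi>"
  by (simp add: bilin_def algebra_simps sum.distrib)

lemma Im_bilin: "Im (bilin z \<xi>) = (\<chi> j. Im (z $ j)) \<bullet> \<xi>"
  by (simp add: bilin_def inner_vec_def)

lemma continuous_on_bilin [continuous_intros]: "continuous_on S (bilin z)"
  unfolding bilin_def[abs_def] by (intro continuous_intros)

section \<open>Functions with vanishing exponential moments\<close>

text \<open>
  A Lebesgue set is, up to a null set, an increasing union of compact sets, so the integral of \<open>G\<close>
  vanishes over every measurable set, in particular where its real or imaginary part has a given sign.
\<close>

lemma integral_zero_on_compacts_imp_AE_zero:
  fixes G :: "'a::euclidean_space \<Rightarrow> complex"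
  assumes S: "S \<in> sets lebesgue" and G: "integrable (lebesgue_on S) G"
    and zero: "\<And>K. compact K \<Longrightarrow> K \<subseteq> S \<Longrightarrow> (\<integral>x. indicator K x *\<^sub>R G x \<partial>lebesgue_on S) = 0"
  shows "AE x in lebesgue_on S. G x = 0"
proof -
  have all: "(\<integral>x. indicator A x *\<^sub>R G x \<partial>lebesgue_on S) = 0" if A: "A \<in> sets (lebesgue_on S)" for A
  proof -
    have "A \<in> sets lebesgue" "A \<subseteq> S" using A S by (auto simp: sets_restrict_space_iff)
    then obtain C T where CT: "fsigma C" "T \<in> null_sets lebesgue" "C \<union> T = A" "disjnt C T"
      using lebesgue_set_almost_fsigma by metis
    then obtain F :: "nat \<Rightarrow> 'a set" where F: "\<And>n. compact (F n)" "C = (\<Union>n. F n)"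
      unfolding fsigma_Union_compact by (metis image_subset_iff mem_Collect_eq UNIV_I)
    define L where "L n = (\<Union>i\<le>n. F i)" for n
    have L: "compact (L n)" "L n \<subseteq> S" for n
      using F \<open>C \<union> T = A\<close> \<open>A \<subseteq> S\<close> by (auto simp: L_def)
    have Lm: "L n \<in> sets (lebesgue_on S)" for n
      using L[of n] S by (auto simp: sets_restrict_space_iff borel_compact)
    have Cm: "C \<in> sets (lebesgue_on S)"
    proof -
      have "C = (\<Union>n. L n)" by (auto simp: L_def F)
      then show ?thesis using Lm by auto
    qed
    have lim: "(\<lambda>n. indicat_real (L n) x) \<longlonglongrightarrow> indicat_real C x" for x
    proof -
      have "incseq L" by (force simp: L_def incseq_def)
      moreover have "C = (\<Union>n. L n)" by (auto simp: L_def F)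
      ultimately show ?thesis using LIMSEQ_indicator_incseq by metis
    qed
    have [measurable]: "G \<in> borel_measurable (lebesgue_on S)" using G by auto
    have "(\<lambda>n. \<integral>x. indicator (L n) x *\<^sub>R G x \<partial>lebesgue_on S) \<longlonglongrightarrow> (\<integral>x. indicator C x *\<^sub>R G x \<partial>lebesgue_on S)"
    proof (rule integral_dominated_convergence[where w="\<lambda>x. norm (G x)"])
      show "(\<lambda>x. indicat_real C x *\<^sub>R G x) \<in> borel_measurable (lebesgue_on S)"
        using Cm by measurable
      show "(\<lambda>x. indicat_real (L i) x *\<^sub>R G x) \<in> borel_measurable (lebesgue_on S)" for i
        using Lm[of i] by measurable
      show "AE x in lebesgue_on S. (\<lambda>i. indicat_real (L i) x *\<^sub>R G x) \<longlonglongrightarrow> indicat_real C x *\<^sub>R G x"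
        by (intro AE_I2 tendsto_intros lim)
      show "AE x in lebesgue_on S. norm (indicat_real (L i) x *\<^sub>R G x) \<le> norm (G x)" for i
        by (intro AE_I2) (simp add: indicator_def)
    qed (use G in auto)
    moreover have "(\<integral>x. indicator (L n) x *\<^sub>R G x \<partial>lebesgue_on S) = 0" for n
      using zero L by blast
    ultimately have C0: "(\<integral>x. indicator C x *\<^sub>R G x \<partial>lebesgue_on S) = 0"
      by (simp add: LIMSEQ_const_iff)
    have "T \<in> null_sets (lebesgue_on S)"
      using CT \<open>A \<subseteq> S\<close> S by (auto simp: null_sets_restrict_space)
    then have "AE x in lebesgue_on S. x \<notin> T" by (rule AE_not_in)
    then have "AE x in lebesgue_on S. indicator A x *\<^sub>R G x = indicator C x *\<^sub>R G x"
      by eventually_elim (use CT in \<open>auto simp: indicator_def\<close>)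
    then have "(\<integral>x. indicator A x *\<^sub>R G x \<partial>lebesgue_on S) = (\<integral>x. indicator C x *\<^sub>R G x \<partial>lebesgue_on S)"
      using A Cm by (intro integral_cong_AE borel_measurable_scaleR borel_measurable_indicator) auto
    then show ?thesis using C0 by simp
  qed
  have ReIm: "(\<integral>x. indicator A x *\<^sub>R Re (G x) \<partial>lebesgue_on S) = 0"
      "(\<integral>x. indicator A x *\<^sub>R Im (G x) \<partial>lebesgue_on S) = 0"
    if A: "A \<in> sets (lebesgue_on S)" for A
  proof -
    have "integrable (lebesgue_on S) (\<lambda>x. indicator A x *\<^sub>R G x)"
      using A G by (rule integrable_mult_indicator)
    from integral_Re[OF this] integral_Im[OF this]
    show "(\<integral>x. indicator A x *\<^sub>R Re (G x) \<partial>lebesgue_on S) = 0"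
      "(\<integral>x. indicator A x *\<^sub>R Im (G x) \<partial>lebesgue_on S) = 0" by (simp_all add: all[OF A])
  qed
  have "AE x in lebesgue_on S. Re (G x) = 0" "AE x in lebesgue_on S. Im (G x) = 0"
    by (rule density_unique_real; use G ReIm in \<open>simp add: set_lebesgue_integral_def\<close>)+
  then show ?thesis by eventually_elim (simp add: complex_eq_iff)
qed

text \<open>
  The functions \<open>h\<close> for which the Laplace transform of \<open>h D\<close> exists and vanishes on \<open>U\<close>. Tracking this
  whole class makes the passage to polynomials an induction: the class is a vector space closed
  under multiplication by \<open>exp (- v \<bullet> \<xi>)\<close> for \<open>v \<in> U\<close>.
\<close>

definition exp_annihilates ::
  "'a::euclidean_space measure \<Rightarrow> 'a set \<Rightarrow> ('a \<Rightarrow> complex) \<Rightarrow> ('a \<Rightarrow> real) \<Rightarrow> bool" where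
  "exp_annihilates M U D h \<longleftrightarrow>
     (\<forall>u\<in>U. has_bochner_integral M (\<lambda>\<xi>. (exp (- (u \<bullet> \<xi>)) * h \<xi>) *\<^sub>R D \<xi>) 0)"

lemma exp_annihilates_add:
  "exp_annihilates M U D g \<Longrightarrow> exp_annihilates M U D h \<Longrightarrow> exp_annihilates M U D (\<lambda>\<xi>. g \<xi> + h \<xi>)"
  unfolding exp_annihilates_def
  using has_bochner_integral_add[of M _ 0 _ 0] by (fastforce simp: algebra_simps)

lemma exp_annihilates_cmult:
  "exp_annihilates M U D h \<Longrightarrow> exp_annihilates M U D (\<lambda>\<xi>. c * h \<xi>)"
  unfolding exp_annihilates_def
  using has_bochner_integral_scaleR_right[of c M _ 0] by (fastforce simp: algebra_simps)

lemma exp_annihilates_sum: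
  "(\<And>i. i \<in> I \<Longrightarrow> exp_annihilates M U D (h i)) \<Longrightarrow> exp_annihilates M U D (\<lambda>\<xi>. \<Sum>i\<in>I. h i \<xi>)"
proof (induction I rule: infinite_finite_induct)
  case (insert i I)
  then show ?case by (simp add: exp_annihilates_add)
qed (simp_all add: exp_annihilates_def has_bochner_integral_zero)

lemma exp_annihilates_exp:
  assumes "\<And>u v. u \<in> U \<Longrightarrow> v \<in> U \<Longrightarrow> u + v \<in> U" "v \<in> U" "exp_annihilates M U D h"
  shows "exp_annihilates M U D (\<lambda>\<xi>. exp (- (v \<bullet> \<xi>)) * h \<xi>)"
  unfolding exp_annihilates_def
proof
  fix u assume "u \<in> U"
  then have "u + v \<in> U" using assms by blast
  moreover have shift: "exp (- (u \<bullet> \<xi>)) * (exp (- (v \<bullet> \<xi>)) * h \<xi>) = exp (- ((u + v) \<bullet> \<xi>)) * h \<xi>" for \<xi>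
    by (simp add: inner_add_left exp_diff exp_minus field_simps)
  ultimately show "has_bochner_integral M (\<lambda>\<xi>. (exp (- (u \<bullet> \<xi>)) * (exp (- (v \<bullet> \<xi>)) * h \<xi>)) *\<^sub>R D \<xi>) 0"
    using assms(3) unfolding exp_annihilates_def shift by blast
qed

text \<open>
  An embedding by decaying exponentials. The exponents \<open>y\<close> and \<open>y + e b\<close> all lie in \<open>U\<close> for \<open>y \<in> U\<close> and
  small \<open>e\<close>; the first coordinate supplies \<open>y \<bullet> \<xi>\<close>, which the other ones need to recover \<open>b \<bullet> \<xi>\<close>.
\<close>

definition exp_chart :: "real \<Rightarrow> 'a \<Rightarrow> 'a::euclidean_space \<Rightarrow> real \<times> 'a" where
  "exp_chart e y \<xi> = (exp (- (y \<bullet> \<xi>)), \<Sum>b\<in>Basis. exp (- ((y + e *\<^sub>R b) \<bullet> \<xi>)) *\<^sub>R b)"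

lemma inj_exp_chart:
  assumes "e \<noteq> 0"
  shows "inj (exp_chart e y)"
proof (rule injI)
  fix \<xi> \<eta> assume eq: "exp_chart e y \<xi> = exp_chart e y \<eta>"
  have fst: "y \<bullet> \<xi> = y \<bullet> \<eta>" using eq by (simp add: exp_chart_def)
  have "\<xi> \<bullet> b = \<eta> \<bullet> b" if b: "b \<in> Basis" for b
  proof -
    have "snd (exp_chart e y \<zeta>) \<bullet> b = exp (- ((y + e *\<^sub>R b) \<bullet> \<zeta>))" for \<zeta>
      using b by (simp add: exp_chart_def inner_sum_left_Basis)
    then have "(y + e *\<^sub>R b) \<bullet> \<xi> = (y + e *\<^sub>R b) \<bullet> \<eta>" using eq by (metis exp_inj_iff neg_equal_iff_equal)
    then show ?thesis using fst assms by (simp add: inner_add_left) (simp add: inner_commute)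
  qed
  then show "\<xi> = \<eta>" by (rule euclidean_eqI)
qed

lemma continuous_on_exp_chart: "continuous_on S (exp_chart e y)"
  unfolding exp_chart_def[abs_def] by (intro continuous_intros)

text \<open>
  The multiplier \<open>h\<close> is kept arbitrary so that a product of polynomials can be absorbed one factor at a
  time. A linear polynomial in the chart is a combination of exponentials with exponents in \<open>U\<close>.
\<close>

lemma exp_annihilates_polynomial:
  assumes add: "\<And>u v. u \<in> U \<Longrightarrow> v \<in> U \<Longrightarrow> u + v \<in> U"
    and y: "y \<in> U" "\<And>b. b \<in> Basis \<Longrightarrow> y + e *\<^sub>R b \<in> U"
    and p: "real_polynomial_function p" and h: "exp_annihilates M U D h"
  shows "exp_annihilates M U D (\<lambda>\<xi>. p (exp_chart e y \<xi>) * h \<xi>)"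
  using p h
proof (induction p arbitrary: h rule: real_polynomial_function.induct)
  case (linear f)
  interpret f: bounded_linear f by fact
  have "f (exp_chart e y \<xi>) * h \<xi> = f (1, 0) * (exp (- (y \<bullet> \<xi>)) * h \<xi>)
     + (\<Sum>b\<in>Basis. f (0, b) * (exp (- ((y + e *\<^sub>R b) \<bullet> \<xi>)) * h \<xi>))" for \<xi>
  proof -
    have "exp_chart e y \<xi> = exp (- (y \<bullet> \<xi>)) *\<^sub>R (1, 0)
        + (\<Sum>b\<in>Basis. exp (- ((y + e *\<^sub>R b) \<bullet> \<xi>)) *\<^sub>R (0, b))"
      by (simp add: exp_chart_def prod_eq_iff fst_sum snd_sum)
    then have "f (exp_chart e y \<xi>) = exp (- (y \<bullet> \<xi>)) * f (1, 0)
        + (\<Sum>b\<in>Basis. exp (- ((y + e *\<^sub>R b) \<bullet> \<xi>)) * f (0, b))"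
      by (simp only: f.add f.sum f.scaleR real_scaleR_def)
    then show ?thesis by (simp add: distrib_right sum_distrib_right mult.assoc mult.left_commute[of _ "f _"])
  qed
  then show ?case
    using y linear(2) add
    by (simp only:) (intro exp_annihilates_add exp_annihilates_sum exp_annihilates_cmult exp_annihilates_exp)
next
  case (const c)
  then show ?case by (rule exp_annihilates_cmult)
next
  case (add f g)
  then show ?case by (simp add: distrib_right exp_annihilates_add)
next
  case (mult f g)
  then show ?case by (simp add: mult.assoc)
qed

text \<open>
  Polynomials in the chart annihilate \<open>E = exp (- y \<bullet> \<xi>) D\<close>, by Stone--Weierstrass so do continuous
  functions of the chart, and by dominated convergence so do the indicators of compact sets.
  The factor \<open>exp (- y \<bullet> \<xi>)\<close> is what makes \<open>D\<close> integrable.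
\<close>

lemma exp_moments_zero_imp_AE_zero:
  fixes D :: "'a::euclidean_space \<Rightarrow> complex"
  assumes S: "S \<in> sets lebesgue"
    and U: "open U" "U \<noteq> {}" and add: "\<And>u v. u \<in> U \<Longrightarrow> v \<in> U \<Longrightarrow> u + v \<in> U"
    and nonneg: "\<And>u \<xi>. u \<in> U \<Longrightarrow> \<xi> \<in> S \<Longrightarrow> 0 \<le> u \<bullet> \<xi>"
    and int: "\<And>u. u \<in> U \<Longrightarrow> has_bochner_integral (lebesgue_on S) (\<lambda>\<xi>. exp (- (u \<bullet> \<xi>)) *\<^sub>R D \<xi>) 0"
  shows "AE \<xi> in lebesgue_on S. D \<xi> = 0"
proof -
  obtain y where y: "y \<in> U" using U by blast
  obtain e where e: "0 < e" "cball y e \<subseteq> U" using U y open_contains_cball by blast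
  have yb: "y + e *\<^sub>R b \<in> U" if "b \<in> Basis" for b
    using e that by (intro subsetD[OF e(2)]) (simp add: dist_norm)
  define T where "T = exp_chart e y"
  define E where "E = (\<lambda>\<xi>. exp (- (y \<bullet> \<xi>)) *\<^sub>R D \<xi>)"
  have E: "integrable (lebesgue_on S) E"
    using int[OF y] by (simp add: E_def has_bochner_integral_iff)
  define Q where "Q = cbox (0::real) 1 \<times> cbox 0 (\<Sum>b\<in>(Basis::'a set). b)"
  have Q: "compact Q" by (simp add: Q_def compact_Times)
  have TQ: "T \<xi> \<in> Q" if "\<xi> \<in> S" for \<xi>
    using nonneg[OF y that] nonneg[OF yb that]
    by (auto simp: T_def Q_def exp_chart_def mem_box inner_sum_left_Basis)
  have Tm: "T \<in> borel_measurable (lebesgue_on S)"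
    unfolding T_def by (rule continuous_imp_measurable_on_sets_lebesgue[OF continuous_on_exp_chart S])
  have Em[measurable]: "E \<in> borel_measurable (lebesgue_on S)" using E by auto
  have poly: "has_bochner_integral (lebesgue_on S) (\<lambda>\<xi>. p (T \<xi>) *\<^sub>R E \<xi>) 0" if "real_polynomial_function p" for p
  proof -
    have "exp_annihilates (lebesgue_on S) U D (\<lambda>\<xi>. 1)" using int by (simp add: exp_annihilates_def)
    from exp_annihilates_polynomial[OF add y yb that this]
    show ?thesis using y by (simp add: exp_annihilates_def T_def E_def mult.commute)
  qed
  have cont_int: "integrable (lebesgue_on S) (\<lambda>\<xi>. h (T \<xi>) *\<^sub>R E \<xi>)"
    if h: "continuous_on UNIV h" for h :: "real \<times> 'a \<Rightarrow> real"
  proof -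
    have "bounded (h ` Q)" by (meson Q h compact_continuous_image compact_imp_bounded continuous_on_subset subset_UNIV)
    then obtain B where B: "\<And>x. x \<in> Q \<Longrightarrow> \<bar>h x\<bar> \<le> B" by (auto simp: bounded_iff)
    have [measurable]: "(\<lambda>\<xi>. h (T \<xi>)) \<in> borel_measurable (lebesgue_on S)"
      using measurable_compose[OF Tm borel_measurable_continuous_onI[OF h]] .
    show ?thesis
    proof (rule Bochner_Integration.integrable_bound)
      show "integrable (lebesgue_on S) (\<lambda>\<xi>. B *\<^sub>R E \<xi>)" using E by simp
      have "\<bar>h (T \<xi>)\<bar> \<le> \<bar>B\<bar>" if "\<xi> \<in> S" for \<xi> using B[OF TQ[OF that]] by linarith
      then show "AE \<xi> in lebesgue_on S. norm (h (T \<xi>) *\<^sub>R E \<xi>) \<le> norm (B *\<^sub>R E \<xi>)"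
        by (intro AE_I2) (auto intro!: mult_right_mono)
    qed measurable
  qed
  have cont: "(\<integral>\<xi>. h (T \<xi>) *\<^sub>R E \<xi> \<partial>lebesgue_on S) = 0"
    if h: "continuous_on UNIV h" for h :: "real \<times> 'a \<Rightarrow> real"
  proof -
    define N where "N = (\<integral>\<xi>. norm (E \<xi>) \<partial>lebesgue_on S)"
    have N: "0 \<le> N" by (simp add: N_def)
    have "norm (\<integral>\<xi>. h (T \<xi>) *\<^sub>R E \<xi> \<partial>lebesgue_on S) \<le> r" if "0 < r" for r
    proof -
      define \<delta> where "\<delta> = r / (N + 1)"
      have \<delta>: "0 < \<delta>" using that N by (simp add: \<delta>_def)
      obtain p where p: "real_polynomial_function p" "\<And>x. x \<in> Q \<Longrightarrow> \<bar>h x - p x\<bar> < \<delta>"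
        using Stone_Weierstrass_real_polynomial_function[OF Q continuous_on_subset[OF h] \<delta>] by auto
      note pE = poly[OF p(1), unfolded has_bochner_integral_iff]
      have "(\<integral>\<xi>. h (T \<xi>) *\<^sub>R E \<xi> \<partial>lebesgue_on S) = (\<integral>\<xi>. h (T \<xi>) *\<^sub>R E \<xi> - p (T \<xi>) *\<^sub>R E \<xi> \<partial>lebesgue_on S)"
        using cont_int[OF h] pE by simp
      also have "norm \<dots> \<le> (\<integral>\<xi>. norm (h (T \<xi>) *\<^sub>R E \<xi> - p (T \<xi>) *\<^sub>R E \<xi>) \<partial>lebesgue_on S)"
        by (rule integral_norm_bound)
      also have "\<dots> \<le> (\<integral>\<xi>. \<delta> * norm (E \<xi>) \<partial>lebesgue_on S)"
      proof (rule integral_mono)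
        show "norm (h (T \<xi>) *\<^sub>R E \<xi> - p (T \<xi>) *\<^sub>R E \<xi>) \<le> \<delta> * norm (E \<xi>)" if "\<xi> \<in> space (lebesgue_on S)" for \<xi>
          using p(2)[OF TQ[of \<xi>]] that
          by (auto simp: scaleR_diff_left[symmetric] simp del: scaleR_conv_of_real intro!: mult_right_mono)
      qed (use cont_int[OF h] pE E in auto)
      also have "\<dots> = \<delta> * N" by (simp add: N_def)
      also have "\<dots> \<le> r" using that N by (simp add: \<delta>_def field_simps)
      finally show ?thesis .
    qed
    then have "norm (\<integral>\<xi>. h (T \<xi>) *\<^sub>R E \<xi> \<partial>lebesgue_on S) \<le> 0" by (rule field_le_epsilon) simp
    then show ?thesis by simp
  qed
  have compact0: "(\<integral>\<xi>. indicator K \<xi> *\<^sub>R E \<xi> \<partial>lebesgue_on S) = 0" if K: "compact K" "K \<subseteq> S" for K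
  proof (cases "K = {}")
    case False
    have TK: "closed (T ` K)" "T ` K \<noteq> {}"
      using compact_continuous_image[OF continuous_on_exp_chart K(1)] False 
      by (auto simp: T_def intro: compact_imp_closed)
    \<comment> \<open>Continuous cut-offs that decrease to the indicator of the image of \<open>K\<close>; injectivity of \<open>T\<close> turns
      it into the indicator of \<open>K\<close>.\<close>
    define h where "h = (\<lambda>(k::nat) x. max 0 (1 - real k * infdist x (T ` K)))"
    have h: "continuous_on UNIV (h k)" for k
      unfolding h_def by (intro continuous_intros)
    have lim: "(\<lambda>k. h k (T \<xi>)) \<longlonglongrightarrow> indicator K \<xi>" for \<xi>
    proof (cases "\<xi> \<in> K")
      case True
      then show ?thesis by (simp add: h_def)
    next
      case False
      then have "T \<xi> \<notin> T ` K" using inj_exp_chart[of e y] e by (auto simp: T_def inj_def)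
      then have pos: "0 < infdist (T \<xi>) (T ` K)"
        using TK in_closed_iff_infdist_zero infdist_nonneg by (metis less_le)
      have "\<forall>\<^sub>F k in sequentially. 1 / infdist (T \<xi>) (T ` K) \<le> real k"
        by (rule eventually_at_top_linorderI[of "nat \<lceil>1 / infdist (T \<xi>) (T ` K)\<rceil>"]) linarith
      then have "\<forall>\<^sub>F k in sequentially. h k (T \<xi>) = indicator K \<xi>"
        by eventually_elim (use pos False in \<open>simp add: h_def field_simps\<close>)
      then show ?thesis by (rule tendsto_eventually)
    qed
    have "(\<lambda>k. \<integral>\<xi>. h k (T \<xi>) *\<^sub>R E \<xi> \<partial>lebesgue_on S) \<longlonglongrightarrow> (\<integral>\<xi>. indicator K \<xi> *\<^sub>R E \<xi> \<partial>lebesgue_on S)"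
    proof (rule integral_dominated_convergence[where w="\<lambda>\<xi>. norm (E \<xi>)"])
      have "K \<in> sets (lebesgue_on S)"
        using K S borel_compact[OF K(1)] by (auto simp: sets_restrict_space_iff)
      then show "(\<lambda>\<xi>. indicat_real K \<xi> *\<^sub>R E \<xi>) \<in> borel_measurable (lebesgue_on S)"
        by (intro borel_measurable_scaleR borel_measurable_indicator Em)
      show "(\<lambda>\<xi>. h k (T \<xi>) *\<^sub>R E \<xi>) \<in> borel_measurable (lebesgue_on S)" for k
        using cont_int[OF h] by auto
      show "AE \<xi> in lebesgue_on S. (\<lambda>k. h k (T \<xi>) *\<^sub>R E \<xi>) \<longlonglongrightarrow> indicat_real K \<xi> *\<^sub>R E \<xi>"
        by (intro AE_I2 tendsto_intros lim)
      have "\<bar>h k x\<bar> \<le> 1" for k x by (simp add: h_def infdist_nonneg)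
      then show "AE \<xi> in lebesgue_on S. norm (h k (T \<xi>) *\<^sub>R E \<xi>) \<le> norm (E \<xi>)" for k
        by (intro AE_I2) (simp add: mult_left_le_one_le)
    qed (use E in auto)
    then show ?thesis using cont[OF h] by (simp add: LIMSEQ_const_iff)
  qed simp
  have "AE \<xi> in lebesgue_on S. E \<xi> = 0"
    by (rule integral_zero_on_compacts_imp_AE_zero[OF S E compact0])
  then show ?thesis by eventually_elim (simp add: E_def)
qed

section \<open>The Laplace transform on the weighted space\<close>

lemma mult_le_sum_squares: "a * b \<le> a\<^sup>2 + b\<^sup>2" if "0 \<le> a" "0 \<le> b" for a b :: real
  using sum_squares_bound[of a b] mult_nonneg_nonneg[OF that] by linarith

lemma sobolev_weight_ge_1: "1 \<le> sobolev_weight \<rho> n \<xi>"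
proof -
  have "sobolev_weight \<rho> n \<xi> = 1 + (\<Sum>k=1..n. \<rho> \<xi> ^ (2 * k))"
    by (simp add: sobolev_weight_def sum.atLeast_Suc_atMost)
  moreover have "0 \<le> (\<Sum>k=1..n. \<rho> \<xi> ^ (2 * k))" by (intro sum_nonneg) simp
  ultimately show ?thesis by simp
qed

lemma open_convex_cone_add:
  assumes "open_convex_cone \<Omega>" "u \<in> \<Omega>" "v \<in> \<Omega>"
  shows "u + v \<in> \<Omega>"
proof -
  have "(1/2) *\<^sub>R u + (1/2) *\<^sub>R v \<in> \<Omega>"
    using assms by (intro convexD) (auto simp: open_convex_cone_def)
  then have "2 *\<^sub>R ((1/2) *\<^sub>R u + (1/2) *\<^sub>R v) \<in> \<Omega>"
    using assms(1) unfolding open_convex_cone_def by (metis zero_less_numeral)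
  then show ?thesis by (simp add: scaleR_add_right)
qed

lemma cmod_exp_bilin: "cmod (exp (\<i> * bilin z \<xi>)) = exp (- ((\<chi> j. Im (z $ j)) \<bullet> \<xi>))"
  by (simp add: norm_exp_eq_Re Im_bilin)

lemma open_tube:
  assumes "open \<Omega>"
  shows "open (tube \<Omega>)"
proof -
  have "tube \<Omega> = (\<lambda>z. \<chi> j. Im (z $ j)) -` \<Omega>" by (auto simp: tube_def)
  moreover have "continuous_on UNIV (\<lambda>z::complex^'d. \<chi> j. Im (z $ j))"
    by (intro continuous_intros)
  ultimately show ?thesis using assms by (metis open_vimage)
qed

lemma borel_measurable_cnj [measurable]: "cnj \<in> borel_measurable borel"
  by (intro borel_measurable_continuous_onI continuous_intros)

text \<open>
  A nonempty \<open>\<Omega>\<close> provides points at which to evaluate transforms, the openness contained in the cone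
  condition provides their exponential decay, and continuity of \<open>\<rho>\<close> makes the weight measurable.
\<close>

locale hardy_sobolev_tube =
  fixes \<Omega> :: "(real ^ 'd) set" and \<rho> :: "real ^ 'd \<Rightarrow> real" and n :: nat
  assumes nonempty: "\<Omega> \<noteq> {}" and cone: "open_convex_cone \<Omega>"
    and rho: "continuous_on (dual_cone \<Omega>) \<rho>"
begin

abbreviation M where "M \<equiv> lebesgue_on (dual_cone \<Omega>)"
abbreviation weight where "weight \<equiv> sobolev_weight \<rho> n"
abbreviation L2 where "L2 \<equiv> weighted_L2 \<Omega> \<rho> n"
abbreviation H where "H \<equiv> hardy_sobolev \<Omega> \<rho> n"
abbreviation inner2 where "inner2 \<equiv> hs_inner \<Omega> \<rho> n"
abbreviation norm2 where "norm2 \<equiv> hs_norm \<Omega> \<rho> n"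

lemma weight_pos: "0 < weight \<xi>" "0 \<le> weight \<xi>"
  using sobolev_weight_ge_1[of \<rho> n \<xi>] by auto

lemma weight_measurable [measurable]: "weight \<in> borel_measurable M"
  unfolding sobolev_weight_def[abs_def]
  by (intro continuous_imp_measurable_on_sets_lebesgue dual_cone_measurable continuous_intros rho)

lemma of_real_weight_measurable [measurable]: "(\<lambda>\<xi>. complex_of_real (weight \<xi>)) \<in> borel_measurable M"
  by (rule measurable_compose[OF weight_measurable borel_measurable_of_real])

lemma exp_bilin_measurable [measurable]: "(\<lambda>\<xi>. exp (\<i> * bilin z \<xi>)) \<in> borel_measurable M"
  by (intro continuous_imp_measurable_on_sets_lebesgue dual_cone_measurable continuous_intros)

lemma exp_norm_measurable [measurable]: "(\<lambda>\<xi>. exp (- c * norm \<xi>)) \<in> borel_measurable M" for c :: real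
  by (intro continuous_imp_measurable_on_sets_lebesgue dual_cone_measurable continuous_intros)

lemma component_measurable [measurable]: "(\<lambda>\<xi>. complex_of_real (\<xi> $ j)) \<in> borel_measurable M"
  by (intro continuous_imp_measurable_on_sets_lebesgue dual_cone_measurable continuous_intros)

lemma L2_measurable: "f \<in> L2 \<Longrightarrow> f \<in> borel_measurable M"
  by (simp add: weighted_L2_def)

lemma L2_integrable: "f \<in> L2 \<Longrightarrow> integrable M (\<lambda>\<xi>. (cmod (f \<xi>))\<^sup>2 * weight \<xi>)"
  by (simp add: weighted_L2_def)

text \<open>
  The product is bounded by the sum of the two squares, and the weight dominates one.
\<close>

lemma L2_exp_integrable:
  assumes f: "f \<in> L2" and c: "0 < c"
  shows "integrable M (\<lambda>\<xi>. exp (- c * norm \<xi>) * cmod (f \<xi>))"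
proof (rule Bochner_Integration.integrable_bound)
  note [measurable] = L2_measurable[OF f]
  show "integrable M (\<lambda>\<xi>. exp (- (2 * c) * norm \<xi>) + (cmod (f \<xi>))\<^sup>2 * weight \<xi>)"
    using c by (intro Bochner_Integration.integrable_add L2_integrable f integrable_exp_neg_norm_lebesgue_on dual_cone_measurable) auto
  show "(\<lambda>\<xi>. exp (- c * norm \<xi>) * cmod (f \<xi>)) \<in> borel_measurable M" by measurable
  have "exp (- c * norm \<xi>) * cmod (f \<xi>) \<le> exp (- (2 * c) * norm \<xi>) + (cmod (f \<xi>))\<^sup>2 * weight \<xi>" for \<xi>
  proof -
    have "exp (- c * norm \<xi>) * cmod (f \<xi>) \<le> (exp (- c * norm \<xi>))\<^sup>2 + (cmod (f \<xi>))\<^sup>2"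
      by (rule mult_le_sum_squares) auto
    also have "(exp (- c * norm \<xi>))\<^sup>2 = exp (- (2 * c) * norm \<xi>)"
      by (simp add: exp_double[symmetric])
    also have "(cmod (f \<xi>))\<^sup>2 \<le> (cmod (f \<xi>))\<^sup>2 * weight \<xi>"
      using mult_left_mono[OF sobolev_weight_ge_1, of "(cmod (f \<xi>))\<^sup>2"] by simp
    finally show ?thesis by simp
  qed
  then show "AE \<xi> in M. norm (exp (- c * norm \<xi>) * cmod (f \<xi>)) \<le> norm (exp (- (2 * c) * norm \<xi>) + (cmod (f \<xi>))\<^sup>2 * weight \<xi>)"
    using weight_pos by (intro AE_I2) auto
qed

lemma tube_exp_bound:
  assumes "z \<in> tube \<Omega>"
  obtains c where "0 < c" "\<And>\<xi>. \<xi> \<in> dual_cone \<Omega> \<Longrightarrow> cmod (exp (\<i> * bilin z \<xi>)) \<le> exp (- c * norm \<xi>)"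
proof -
  have y: "(\<chi> j. Im (z $ j)) \<in> \<Omega>" using assms by (simp add: tube_def)
  obtain c where "0 < c" "\<And>\<xi>. \<xi> \<in> dual_cone \<Omega> \<Longrightarrow> c * norm \<xi> \<le> (\<chi> j. Im (z $ j)) \<bullet> \<xi>"
    using dual_cone_exp_bound[OF cone y] by blast
  then show ?thesis by (intro that[of c]) (simp_all add: cmod_exp_bilin del: norm_exp_eq_Re)
qed

lemma laplace_integrable:
  assumes f: "f \<in> L2" and z: "z \<in> tube \<Omega>"
  shows "integrable M (\<lambda>\<xi>. exp (\<i> * bilin z \<xi>) * f \<xi>)"
proof -
  note [measurable] = L2_measurable[OF f]
  obtain c where c: "0 < c" "\<And>\<xi>. \<xi> \<in> dual_cone \<Omega> \<Longrightarrow> cmod (exp (\<i> * bilin z \<xi>)) \<le> exp (- c * norm \<xi>)"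
    using tube_exp_bound[OF z] by blast
  show ?thesis
  proof (rule Bochner_Integration.integrable_bound[OF L2_exp_integrable[OF f c(1)]])
    show "AE \<xi> in M. cmod (exp (\<i> * bilin z \<xi>) * f \<xi>) \<le> norm (exp (- c * norm \<xi>) * cmod (f \<xi>))"
      using c(2) by (intro AE_I2) (auto simp: norm_mult intro!: mult_right_mono)
  qed measurable
qed

text \<open>
  The exponential factors out and the second-order Taylor remainder of \<open>exp\<close> at \<open>v = i \<langle>h,\<xi>\<rangle>\<close> is at most
  \<open>exp \<bar>v\<bar> \<bar>v\<bar>\<^sup>2\<close> with \<open>\<bar>v\<bar> \<le> \<parallel>h\<parallel> \<parallel>\<xi>\<parallel>\<close>. For small \<open>h\<close>, the factors \<open>exp \<bar>v\<bar>\<close> and \<open>\<parallel>\<xi>\<parallel>\<^sup>2\<close> each cost a quarter of the decay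
  rate \<open>c\<close>, leaving one half.
\<close>

lemma exp_remainder_bound:
  assumes c: "0 < c" and e: "cmod (exp (\<i> * bilin z \<xi>)) \<le> exp (- c * norm \<xi>)" and h: "norm h \<le> c / 4"
  shows "cmod (exp (\<i> * bilin (z + h) \<xi>) - exp (\<i> * bilin z \<xi>) - \<i> * bilin h \<xi> * exp (\<i> * bilin z \<xi>))
    \<le> (64 / c\<^sup>2) * (norm h)\<^sup>2 * exp (- (c / 2) * norm \<xi>)"
proof -
  define v where "v = \<i> * bilin h \<xi>"
  define r where "r = norm \<xi>"
  have v: "cmod v \<le> norm h * r" by (simp add: v_def r_def norm_mult norm_bilin_le)
  have "exp (\<i> * bilin (z + h) \<xi>) = exp (\<i> * bilin z \<xi>) * exp v"
    by (simp add: v_def bilin_add distrib_left exp_add)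
  then have "cmod (exp (\<i> * bilin (z + h) \<xi>) - exp (\<i> * bilin z \<xi>) - v * exp (\<i> * bilin z \<xi>))
      = cmod (exp (\<i> * bilin z \<xi>) * (exp v - 1 - v))"
    by (simp add: algebra_simps)
  also have "\<dots> = cmod (exp (\<i> * bilin z \<xi>)) * cmod (exp v - 1 - v)" by (rule norm_mult)
  also have "\<dots> \<le> exp (- c * r) * (exp (norm h * r) * (norm h * r)\<^sup>2)"
  proof (intro mult_mono)
    have "cmod (exp v - 1 - v) \<le> exp (cmod v) * (cmod v)\<^sup>2"
      using Taylor_exp_field[of v 1] by (simp add: power2_eq_square algebra_simps)
    also have "\<dots> \<le> exp (norm h * r) * (norm h * r)\<^sup>2"
      using v by (intro mult_mono power_mono) auto
    finally show "cmod (exp v - 1 - v) \<le> exp (norm h * r) * (norm h * r)\<^sup>2" .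
  qed (use e in \<open>auto simp: r_def\<close>)
  also have "\<dots> \<le> exp (- c * r) * (exp ((c / 4) * r) * ((norm h)\<^sup>2 * ((64 / c\<^sup>2) * exp ((c / 4) * r))))"
  proof -
    \<comment> \<open>Squaring this turns \<open>c / 8\<close> into the quarter \<open>c / 4\<close> and produces the constant \<open>64 / c\<^sup>2\<close>.\<close>
    have "c / 8 * r \<le> exp (c / 8 * r)" using exp_ge_add_one_self[of "c / 8 * r"] by linarith
    then have "(c / 8 * r)\<^sup>2 \<le> (exp (c / 8 * r))\<^sup>2"
      using c by (intro power_mono) (auto simp: r_def)
    also have "(exp (c / 8 * r))\<^sup>2 = exp (c / 4 * r)" by (simp add: exp_double[symmetric])
    finally have "r\<^sup>2 \<le> (64 / c\<^sup>2) * exp (c / 4 * r)"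
      using c by (simp add: power_mult_distrib power_divide field_simps)
    then have "(norm h * r)\<^sup>2 \<le> (norm h)\<^sup>2 * ((64 / c\<^sup>2) * exp ((c / 4) * r))"
      unfolding power_mult_distrib by (intro mult_left_mono) auto
    moreover have "exp (norm h * r) \<le> exp ((c / 4) * r)"
      using mult_right_mono[OF h, of r] by (simp add: r_def)
    ultimately show ?thesis by (intro mult_left_mono mult_mono) auto
  qed
  also have "\<dots> = (64 / c\<^sup>2) * (norm h)\<^sup>2 * (exp (- c * r) * exp ((c / 4) * r) * exp ((c / 4) * r))" by simp
  also have "exp (- c * r) * exp ((c / 4) * r) * exp ((c / 4) * r) = exp (- (c / 2) * r)"
    by (simp add: exp_add[symmetric] algebra_simps)
  finally show ?thesis by (simp add: v_def r_def)
qed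

text \<open>
  Differentiation under the integral sign: integrating the pointwise remainder bound gives a remainder
  of order \<open>\<parallel>h\<parallel>\<^sup>2\<close>, with the candidate derivative \<open>a\<^sub>j = \<integral> i \<xi>\<^sub>j exp (i \<langle>z,\<xi>\<rangle>) f(\<xi>) d\<xi>\<close>.
\<close>

lemma laplace_holomorphic:
  assumes f: "f \<in> L2"
  shows "holomorphic_cn_on (laplace \<Omega> f) (tube \<Omega>)"
  unfolding holomorphic_cn_on_def
proof
  fix z assume z: "z \<in> tube \<Omega>"
  note [measurable] = L2_measurable[OF f]
  obtain c where c: "0 < c" and ec: "\<And>\<xi>. \<xi> \<in> dual_cone \<Omega> \<Longrightarrow> cmod (exp (\<i> * bilin z \<xi>)) \<le> exp (- c * norm \<xi>)"
    using tube_exp_bound[OF z] by blast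
  define E where "E = (\<lambda>\<xi>. exp (\<i> * bilin z \<xi>) * f \<xi>)"
  have [measurable]: "E \<in> borel_measurable M" by (simp add: E_def)
  have int: "integrable M (\<lambda>\<xi>. \<i> * complex_of_real (\<xi> $ j) * E \<xi>)" for j
  proof (rule Bochner_Integration.integrable_bound)
    show "integrable M (\<lambda>\<xi>. (2 / c) * (exp (- (c / 2) * norm \<xi>) * cmod (f \<xi>)))"
      using c by (intro integrable_mult_right L2_exp_integrable f) auto
    have "cmod (\<i> * complex_of_real (\<xi> $ j) * E \<xi>) \<le> (2 / c) * (exp (- (c / 2) * norm \<xi>) * cmod (f \<xi>))"
      if \<xi>: "\<xi> \<in> dual_cone \<Omega>" for \<xi>
    proof -
      have "c / 2 * \<bar>\<xi> $ j\<bar> \<le> c / 2 * norm \<xi>"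
        using c by (intro mult_left_mono component_le_norm_cart) auto
      also have "\<dots> \<le> exp (c / 2 * norm \<xi>)" using exp_ge_add_one_self[of "c / 2 * norm \<xi>"] by linarith
      finally have "\<bar>\<xi> $ j\<bar> \<le> (2 / c) * exp (c / 2 * norm \<xi>)" using c by (simp add: field_simps)
      then have "\<bar>\<xi> $ j\<bar> * cmod (exp (\<i> * bilin z \<xi>)) \<le> ((2 / c) * exp (c / 2 * norm \<xi>)) * exp (- c * norm \<xi>)"
        using c ec[OF \<xi>] by (intro mult_mono) auto
      also have "\<dots> = (2 / c) * exp (- (c / 2) * norm \<xi>)"
        by (simp add: exp_add[symmetric] mult.assoc)
      finally have "\<bar>\<xi> $ j\<bar> * cmod (exp (\<i> * bilin z \<xi>)) * cmod (f \<xi>) \<le> (2 / c) * exp (- (c / 2) * norm \<xi>) * cmod (f \<xi>)"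
        by (rule mult_right_mono) simp
      then show ?thesis by (simp add: E_def norm_mult mult.assoc)
    qed
    then show "AE \<xi> in M. cmod (\<i> * complex_of_real (\<xi> $ j) * E \<xi>) \<le> norm ((2 / c) * (exp (- (c / 2) * norm \<xi>) * cmod (f \<xi>)))"
      using c by (intro AE_I2) (auto simp: abs_mult)
  qed measurable
  define a where "a = (\<chi> j. \<integral>\<xi>. \<i> * complex_of_real (\<xi> $ j) * E \<xi> \<partial>M)"
  have lin: "has_bochner_integral M (\<lambda>\<xi>. \<i> * bilin h \<xi> * E \<xi>) (\<Sum>j\<in>UNIV. a $ j * h $ j)" for h
  proof -
    have "has_bochner_integral M (\<lambda>\<xi>. \<Sum>j\<in>UNIV. (\<i> * complex_of_real (\<xi> $ j) * E \<xi>) * h $ j) (\<Sum>j\<in>UNIV. a $ j * h $ j)"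
      by (intro has_bochner_integral_sum has_bochner_integral_mult_left)
         (simp add: a_def has_bochner_integral_integrable int)
    moreover have "(\<Sum>j\<in>UNIV. (\<i> * complex_of_real (\<xi> $ j) * E \<xi>) * h $ j) = \<i> * bilin h \<xi> * E \<xi>" for \<xi>
      by (simp add: bilin_def sum_distrib_left sum_distrib_right mult_ac)
    ultimately show ?thesis by simp
  qed
  define K where "K = (64 / c\<^sup>2) * (\<integral>\<xi>. exp (- (c / 2) * norm \<xi>) * cmod (f \<xi>) \<partial>M)"
  have bound: "cmod (laplace \<Omega> f (z + h) - laplace \<Omega> f z - (\<Sum>j\<in>UNIV. a $ j * h $ j)) \<le> K * (norm h)\<^sup>2"
    if h: "norm h \<le> c / 4" "z + h \<in> tube \<Omega>" for h
  proof -
    have "laplace \<Omega> f (z + h) - laplace \<Omega> f z - (\<Sum>j\<in>UNIV. a $ j * h $ j)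
       = (\<integral>\<xi>. exp (\<i> * bilin (z + h) \<xi>) * f \<xi> - E \<xi> - \<i> * bilin h \<xi> * E \<xi> \<partial>M)"
      using z h lin[of h] laplace_integrable[OF f z] laplace_integrable[OF f h(2)]
      by (simp add: laplace_def E_def has_bochner_integral_iff)
    also have "cmod \<dots> \<le> (\<integral>\<xi>. cmod (exp (\<i> * bilin (z + h) \<xi>) * f \<xi> - E \<xi> - \<i> * bilin h \<xi> * E \<xi>) \<partial>M)"
      by (rule integral_norm_bound)
    also have "\<dots> \<le> (\<integral>\<xi>. (64 / c\<^sup>2) * (norm h)\<^sup>2 * (exp (- (c / 2) * norm \<xi>) * cmod (f \<xi>)) \<partial>M)"
    proof (rule integral_mono)
      show "integrable M (\<lambda>\<xi>. cmod (exp (\<i> * bilin (z + h) \<xi>) * f \<xi> - E \<xi> - \<i> * bilin h \<xi> * E \<xi>))"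
        using lin[of h] laplace_integrable[OF f z] laplace_integrable[OF f h(2)]
        by (intro integrable_norm Bochner_Integration.integrable_diff) (auto simp: E_def has_bochner_integral_iff)
      show "integrable M (\<lambda>\<xi>. (64 / c\<^sup>2) * (norm h)\<^sup>2 * (exp (- (c / 2) * norm \<xi>) * cmod (f \<xi>)))"
        using c by (intro integrable_mult_right L2_exp_integrable f) auto
      fix \<xi> assume "\<xi> \<in> space M"
      then have \<xi>: "\<xi> \<in> dual_cone \<Omega>" by simp
      have "exp (\<i> * bilin (z + h) \<xi>) * f \<xi> - E \<xi> - \<i> * bilin h \<xi> * E \<xi>
        = (exp (\<i> * bilin (z + h) \<xi>) - exp (\<i> * bilin z \<xi>) - \<i> * bilin h \<xi> * exp (\<i> * bilin z \<xi>)) * f \<xi>"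
        by (simp add: E_def algebra_simps)
      then show "cmod (exp (\<i> * bilin (z + h) \<xi>) * f \<xi> - E \<xi> - \<i> * bilin h \<xi> * E \<xi>)
         \<le> (64 / c\<^sup>2) * (norm h)\<^sup>2 * (exp (- (c / 2) * norm \<xi>) * cmod (f \<xi>))"
        using mult_right_mono[OF exp_remainder_bound[OF c ec[OF \<xi>] h(1)], of "cmod (f \<xi>)"]
        by (simp only: norm_mult mult.assoc norm_ge_zero) 
    qed
    also have "\<dots> = K * (norm h)\<^sup>2" by (simp add: K_def)
    finally show ?thesis .
  qed
  have "(laplace \<Omega> f has_derivative (\<lambda>h. \<Sum>j\<in>UNIV. a $ j * h $ j)) (at z)"
    unfolding has_derivative_at
  proof
    show "bounded_linear (\<lambda>h. \<Sum>j\<in>UNIV. a $ j * h $ j)"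
      by (intro bounded_linear_sum bounded_linear_const_mult bounded_linear_vec_nth)
    obtain d where d: "0 < d" "cball z d \<subseteq> tube \<Omega>"
      using open_tube[of \<Omega>] cone z open_contains_cball unfolding open_convex_cone_def by blast
    show "(\<lambda>h. cmod (laplace \<Omega> f (z + h) - laplace \<Omega> f z - (\<Sum>j\<in>UNIV. a $ j * h $ j)) / norm h) \<midarrow>0\<rightarrow> 0"
    proof (rule Lim_null_comparison)
      show "((\<lambda>h. K * norm h) \<longlongrightarrow> 0) (at (0 :: complex ^ 'd))"
        by (auto intro!: tendsto_eq_intros)
      have "norm (cmod (laplace \<Omega> f (z + h) - laplace \<Omega> f z - (\<Sum>j\<in>UNIV. a $ j * h $ j)) / norm h) \<le> K * norm h"
        if h: "h \<noteq> 0" "dist h 0 < min d (c / 4)" for h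
      proof -
        have "z + h \<in> tube \<Omega>" using d h by (intro subsetD[OF d(2)]) (simp add: dist_norm)
        then show ?thesis using bound[of h] h by (simp add: divide_simps power2_eq_square mult.assoc)
      qed
      then show "\<forall>\<^sub>F h in at 0. norm (cmod (laplace \<Omega> f (z + h) - laplace \<Omega> f z - (\<Sum>j\<in>UNIV. a $ j * h $ j)) / norm h) \<le> K * norm h"
        unfolding eventually_at using d c by (intro exI[of _ "min d (c / 4)"]) auto
    qed
  qed
  then show "\<exists>a. (laplace \<Omega> f has_derivative (\<lambda>h. \<Sum>j\<in>UNIV. a $ j * h $ j)) (at z)" by blast
qed

text \<open>
  At \<open>z = i u\<close> with \<open>u \<in> \<Omega>\<close> the kernel of the transform is the real exponential \<open>exp (- u \<bullet> \<xi>)\<close>, so all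
  exponential moments of \<open>f - g\<close> vanish.
\<close>

lemma laplace_injective:
  assumes f: "f \<in> L2" and g: "g \<in> L2" and eq: "laplace \<Omega> f = laplace \<Omega> g"
  shows "AE \<xi> in M. f \<xi> = g \<xi>"
proof -
  have "AE \<xi> in M. f \<xi> - g \<xi> = 0"
  proof (rule exp_moments_zero_imp_AE_zero[OF dual_cone_measurable _ nonempty open_convex_cone_add[OF cone]])
    show "open \<Omega>" using cone by (simp add: open_convex_cone_def)
    show "0 \<le> u \<bullet> \<xi>" if "u \<in> \<Omega>" "\<xi> \<in> dual_cone \<Omega>" for u \<xi> using that by (simp add: dual_cone_def)
    fix u assume u: "u \<in> \<Omega>"
    define z where "z = (\<chi> j. \<i> * complex_of_real (u $ j))"
    have z: "z \<in> tube \<Omega>" using u by (simp add: z_def tube_def)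
    have e: "exp (\<i> * bilin z \<xi>) = complex_of_real (exp (- (u \<bullet> \<xi>)))" for \<xi>
    proof -
      have "\<i> * bilin z \<xi> = complex_of_real (- (u \<bullet> \<xi>))"
        by (simp add: bilin_def z_def inner_vec_def sum_distrib_left mult.assoc[symmetric] sum_negf)
      then show ?thesis by (simp only: exp_of_real)
    qed
    have "integrable M (\<lambda>\<xi>. exp (\<i> * bilin z \<xi>) * f \<xi>)" "integrable M (\<lambda>\<xi>. exp (\<i> * bilin z \<xi>) * g \<xi>)"
      using laplace_integrable z f g by blast+
    moreover have "(\<integral>\<xi>. exp (\<i> * bilin z \<xi>) * f \<xi> \<partial>M) = (\<integral>\<xi>. exp (\<i> * bilin z \<xi>) * g \<xi> \<partial>M)"
      using fun_cong[OF eq, of z] z by (simp add: laplace_def)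
    ultimately show "has_bochner_integral M (\<lambda>\<xi>. exp (- (u \<bullet> \<xi>)) *\<^sub>R (f \<xi> - g \<xi>)) 0"
      by (simp add: e has_bochner_integral_iff scaleR_conv_of_real right_diff_distrib)
  qed
  then show ?thesis by eventually_elim simp
qed

section \<open>The inner product of the Hardy--Sobolev space\<close>

lemma L2_inner_integrable:
  assumes f: "f \<in> L2" and g: "g \<in> L2"
  shows "integrable M (\<lambda>\<xi>. f \<xi> * cnj (g \<xi>) * complex_of_real (weight \<xi>))"
proof (rule Bochner_Integration.integrable_bound)
  note [measurable] = L2_measurable[OF f] L2_measurable[OF g]
  show "integrable M (\<lambda>\<xi>. (cmod (f \<xi>))\<^sup>2 * weight \<xi> + (cmod (g \<xi>))\<^sup>2 * weight \<xi>)"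
    by (intro Bochner_Integration.integrable_add L2_integrable f g)
  show "(\<lambda>\<xi>. f \<xi> * cnj (g \<xi>) * complex_of_real (weight \<xi>)) \<in> borel_measurable M" by measurable
  have "cmod (f \<xi>) * cmod (g \<xi>) * weight \<xi> \<le> ((cmod (f \<xi>))\<^sup>2 + (cmod (g \<xi>))\<^sup>2) * weight \<xi>" for \<xi>
    using weight_pos by (intro mult_right_mono mult_le_sum_squares) auto
  then show "AE \<xi> in M. cmod (f \<xi> * cnj (g \<xi>) * complex_of_real (weight \<xi>))
      \<le> norm ((cmod (f \<xi>))\<^sup>2 * weight \<xi> + (cmod (g \<xi>))\<^sup>2 * weight \<xi>)"
    using weight_pos by (intro AE_I2) (simp add: norm_mult distrib_right)
qed

text \<open>
  Splitting the weight as a product of two square roots reduces this to the unweighted inequality for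
  nonnegative functions.
\<close>

lemma L2_Cauchy_Schwarz:
  assumes f: "f \<in> L2" and g: "g \<in> L2"
  shows "(cmod (\<integral>\<xi>. f \<xi> * cnj (g \<xi>) * complex_of_real (weight \<xi>) \<partial>M))\<^sup>2
    \<le> (\<integral>\<xi>. (cmod (f \<xi>))\<^sup>2 * weight \<xi> \<partial>M) * (\<integral>\<xi>. (cmod (g \<xi>))\<^sup>2 * weight \<xi> \<partial>M)"
proof -
  note [measurable] = L2_measurable[OF f] L2_measurable[OF g]
  define s where "s = (\<lambda>\<xi>. sqrt (weight \<xi>))"
  have s: "(cmod (p \<xi>))\<^sup>2 * weight \<xi> = (cmod (p \<xi>) * s \<xi>)\<^sup>2" for p :: "real ^ 'd \<Rightarrow> complex" and \<xi>
    using weight_pos[of \<xi>] by (simp add: s_def power_mult_distrib)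
  have s0: "0 \<le> s \<xi>" for \<xi> using weight_pos[of \<xi>] by (simp add: s_def)
  have [measurable]: "s \<in> borel_measurable M" unfolding s_def by measurable
  let ?I = "\<integral>\<xi>. cmod (f \<xi>) * cmod (g \<xi>) * weight \<xi> \<partial>M"
  have fg: "integrable M (\<lambda>\<xi>. cmod (f \<xi>) * cmod (g \<xi>) * weight \<xi>)"
    using integrable_norm[OF L2_inner_integrable[OF f g]] weight_pos by (simp add: norm_mult)
  have "ennreal (?I\<^sup>2) = (\<integral>\<^sup>+\<xi>. ennreal (cmod (f \<xi>) * s \<xi>) * ennreal (cmod (g \<xi>) * s \<xi>) \<partial>M)\<^sup>2"
  proof -
    have "(\<integral>\<^sup>+\<xi>. ennreal (cmod (f \<xi>) * s \<xi>) * ennreal (cmod (g \<xi>) * s \<xi>) \<partial>M)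
        = (\<integral>\<^sup>+\<xi>. ennreal (cmod (f \<xi>) * cmod (g \<xi>) * weight \<xi>) \<partial>M)"
      using s0 weight_pos by (intro nn_integral_cong) (simp add: ennreal_mult[symmetric] s_def mult_ac)
    also have "\<dots> = ennreal ?I"
      using fg weight_pos by (intro nn_integral_eq_integral) auto
    finally show ?thesis using weight_pos by (simp add: ennreal_power)
  qed
  also have "\<dots> \<le> (\<integral>\<^sup>+\<xi>. (ennreal (cmod (f \<xi>) * s \<xi>))\<^sup>2 \<partial>M) * (\<integral>\<^sup>+\<xi>. (ennreal (cmod (g \<xi>) * s \<xi>))\<^sup>2 \<partial>M)"
    by (rule Cauchy_Schwarz_nn_integral) measurable
  also have "\<dots> = ennreal ((\<integral>\<xi>. (cmod (f \<xi>))\<^sup>2 * weight \<xi> \<partial>M) * (\<integral>\<xi>. (cmod (g \<xi>))\<^sup>2 * weight \<xi> \<partial>M))"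
  proof -
    have "(\<integral>\<^sup>+\<xi>. (ennreal (cmod (p \<xi>) * s \<xi>))\<^sup>2 \<partial>M) = ennreal (\<integral>\<xi>. (cmod (p \<xi>))\<^sup>2 * weight \<xi> \<partial>M)"
      if "p \<in> L2" for p
      using L2_integrable[OF that] s0 unfolding s
      by (subst nn_integral_eq_integral[symmetric]) (simp_all add: ennreal_power)
    then show ?thesis using f g weight_pos by (simp add: ennreal_mult)
  qed
  finally have "?I\<^sup>2 \<le> (\<integral>\<xi>. (cmod (f \<xi>))\<^sup>2 * weight \<xi> \<partial>M) * (\<integral>\<xi>. (cmod (g \<xi>))\<^sup>2 * weight \<xi> \<partial>M)"
    using weight_pos by (subst (asm) ennreal_le_iff) auto
  moreover have "cmod (\<integral>\<xi>. f \<xi> * cnj (g \<xi>) * complex_of_real (weight \<xi>) \<partial>M) \<le> ?I"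
    using integral_norm_bound[of M "\<lambda>\<xi>. f \<xi> * cnj (g \<xi>) * complex_of_real (weight \<xi>)"] weight_pos
    by (simp add: norm_mult)
  ultimately show ?thesis by (meson norm_ge_zero order_trans power_mono)
qed

lemma H_E:
  assumes "F \<in> H"
  shows "inv_laplace \<Omega> \<rho> n F \<in> L2" "F = laplace \<Omega> (inv_laplace \<Omega> \<rho> n F)"
proof -
  have "\<exists>f. f \<in> L2 \<and> F = laplace \<Omega> f" using assms by (auto simp: hardy_sobolev_def)
  from someI_ex[OF this] show "inv_laplace \<Omega> \<rho> n F \<in> L2" "F = laplace \<Omega> (inv_laplace \<Omega> \<rho> n F)"
    by (simp_all add: inv_laplace_def)
qed

lemma laplace_in_H: "f \<in> L2 \<Longrightarrow> laplace \<Omega> f \<in> H"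
  by (auto simp: hardy_sobolev_def laplace_holomorphic)

lemma inv_laplace_laplace:
  assumes "f \<in> L2"
  shows "AE \<xi> in M. inv_laplace \<Omega> \<rho> n (laplace \<Omega> f) \<xi> = f \<xi>"
  using H_E[OF laplace_in_H[OF assms]] assms by (intro laplace_injective) auto

text \<open>
  The inner product does not depend on the preimages chosen in its definition; this is where
  injectivity of the transform is used.
\<close>

lemma inner2_laplace:
  assumes f: "f \<in> L2" and g: "g \<in> L2"
  shows "inner2 (laplace \<Omega> f) (laplace \<Omega> g) = (\<integral>\<xi>. f \<xi> * cnj (g \<xi>) * complex_of_real (weight \<xi>) \<partial>M)"
  unfolding hs_inner_def
proof (rule integral_cong_AE)
  note [measurable] = L2_measurable[OF f] L2_measurable[OF g]
    L2_measurable[OF H_E(1)[OF laplace_in_H[OF f]]] L2_measurable[OF H_E(1)[OF laplace_in_H[OF g]]]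
  show "(\<lambda>\<xi>. inv_laplace \<Omega> \<rho> n (laplace \<Omega> f) \<xi> * cnj (inv_laplace \<Omega> \<rho> n (laplace \<Omega> g) \<xi>) * complex_of_real (weight \<xi>)) \<in> borel_measurable M"
    by measurable
  show "(\<lambda>\<xi>. f \<xi> * cnj (g \<xi>) * complex_of_real (weight \<xi>)) \<in> borel_measurable M" by measurable
  show "AE \<xi> in M. inv_laplace \<Omega> \<rho> n (laplace \<Omega> f) \<xi> * cnj (inv_laplace \<Omega> \<rho> n (laplace \<Omega> g) \<xi>) * complex_of_real (weight \<xi>)
     = f \<xi> * cnj (g \<xi>) * complex_of_real (weight \<xi>)"
    using inv_laplace_laplace[OF f] inv_laplace_laplace[OF g] by eventually_elim simp
qed

lemma inner2_cnj: "cnj (inner2 F G) = inner2 G F"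
  unfolding hs_inner_def Bochner_Integration.integral_cnj[symmetric] by (simp add: mult_ac)

lemma inner2_self: "inner2 F F = complex_of_real (\<integral>\<xi>. (cmod (inv_laplace \<Omega> \<rho> n F \<xi>))\<^sup>2 * weight \<xi> \<partial>M)"
  unfolding hs_inner_def integral_complex_of_real[symmetric]
  by (simp add: complex_norm_square[symmetric] del: of_real_power) 

lemma norm2_nonneg: "0 \<le> norm2 F"
  using weight_pos by (simp add: hs_norm_def inner2_self)

lemma norm2_square: "(norm2 F)\<^sup>2 = (\<integral>\<xi>. (cmod (inv_laplace \<Omega> \<rho> n F \<xi>))\<^sup>2 * weight \<xi> \<partial>M)"
  using weight_pos by (simp add: hs_norm_def inner2_self)

lemma inner2_self_norm: "inner2 F F = complex_of_real ((norm2 F)\<^sup>2)"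
  by (simp only: inner2_self norm2_square)

lemma inner2_Cauchy_Schwarz:
  assumes "F \<in> H" "G \<in> H"
  shows "cmod (inner2 F G) \<le> norm2 F * norm2 G"
proof (rule power2_le_imp_le)
  show "(cmod (inner2 F G))\<^sup>2 \<le> (norm2 F * norm2 G)\<^sup>2"
    unfolding power_mult_distrib norm2_square
    using L2_Cauchy_Schwarz[OF H_E(1)[OF assms(1)] H_E(1)[OF assms(2)]] by (simp add: hs_inner_def)
qed (simp add: norm2_nonneg)

lemma H_scale:
  assumes F: "F \<in> H"
  shows "(\<lambda>z\<in>tube \<Omega>. c * F z) \<in> H" "norm2 (\<lambda>z\<in>tube \<Omega>. c * F z) = cmod c * norm2 F"
proof -
  define f where "f = inv_laplace \<Omega> \<rho> n F"
  have f: "f \<in> L2" "F = laplace \<Omega> f" using H_E[OF F] by (simp_all add: f_def)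
  note [measurable] = L2_measurable[OF f(1)]
  have "(\<lambda>\<xi>. (cmod (c * f \<xi>))\<^sup>2 * weight \<xi>) = (\<lambda>\<xi>. (cmod c)\<^sup>2 * ((cmod (f \<xi>))\<^sup>2 * weight \<xi>))"
    by (simp add: norm_mult power_mult_distrib mult_ac)
  then have cf: "(\<lambda>\<xi>. c * f \<xi>) \<in> L2"
    using L2_integrable[OF f(1)] by (simp add: weighted_L2_def)
  have eq: "(\<lambda>z\<in>tube \<Omega>. c * F z) = laplace \<Omega> (\<lambda>\<xi>. c * f \<xi>)"
  proof (rule ext)
    fix z
    have "(\<integral>\<xi>. exp (\<i> * bilin z \<xi>) * (c * f \<xi>) \<partial>M) = c * (\<integral>\<xi>. exp (\<i> * bilin z \<xi>) * f \<xi> \<partial>M)"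
      by (simp add: mult.left_commute[of _ c])
    then show "(\<lambda>z\<in>tube \<Omega>. c * F z) z = laplace \<Omega> (\<lambda>\<xi>. c * f \<xi>) z"
      by (simp add: f(2) laplace_def)
  qed
  show "(\<lambda>z\<in>tube \<Omega>. c * F z) \<in> H" unfolding eq by (rule laplace_in_H[OF cf])
  have "inner2 (laplace \<Omega> (\<lambda>\<xi>. c * f \<xi>)) (laplace \<Omega> (\<lambda>\<xi>. c * f \<xi>)) = c * cnj c * inner2 (laplace \<Omega> f) (laplace \<Omega> f)"
  proof -
    have "(c * f \<xi>) * cnj (c * f \<xi>) * complex_of_real (weight \<xi>) = (c * cnj c) * (f \<xi> * cnj (f \<xi>) * complex_of_real (weight \<xi>))" for \<xi>
      by simp
    then show ?thesis by (simp only: inner2_laplace[OF cf cf] inner2_laplace[OF f(1) f(1)] integral_mult_right_zero)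
  qed
  also have "c * cnj c = complex_of_real ((cmod c)\<^sup>2)" by (rule complex_norm_square[symmetric])
  finally have "(norm2 (laplace \<Omega> (\<lambda>\<xi>. c * f \<xi>)))\<^sup>2 = (cmod c * norm2 F)\<^sup>2"
    unfolding inner2_self_norm of_real_mult[symmetric] of_real_eq_iff f(2) power_mult_distrib .
  then show "norm2 (\<lambda>z\<in>tube \<Omega>. c * F z) = cmod c * norm2 F"
    unfolding eq by (rule power2_eq_imp_eq) (simp_all add: norm2_nonneg)
qed

section \<open>The reproducing kernel\<close>

definition kernel_symbol :: "complex ^ 'd \<Rightarrow> real ^ 'd \<Rightarrow> complex" where
  "kernel_symbol w \<xi> = cnj (exp (\<i> * bilin w \<xi>)) / complex_of_real (weight \<xi>)"

lemma kernel_symbol_L2: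
  assumes w: "w \<in> tube \<Omega>"
  shows "kernel_symbol w \<in> L2"
proof -
  have [measurable]: "kernel_symbol w \<in> borel_measurable M"
    unfolding kernel_symbol_def[abs_def] by measurable
  obtain c where c: "0 < c" "\<And>\<xi>. \<xi> \<in> dual_cone \<Omega> \<Longrightarrow> cmod (exp (\<i> * bilin w \<xi>)) \<le> exp (- c * norm \<xi>)"
    using tube_exp_bound[OF w] by blast
  have "integrable M (\<lambda>\<xi>. (cmod (kernel_symbol w \<xi>))\<^sup>2 * weight \<xi>)"
  proof (rule Bochner_Integration.integrable_bound)
    show "integrable M (\<lambda>\<xi>. exp (- (2 * c) * norm \<xi>))"
      using c by (intro integrable_exp_neg_norm_lebesgue_on dual_cone_measurable) auto
    have "(cmod (kernel_symbol w \<xi>))\<^sup>2 * weight \<xi> \<le> exp (- (2 * c) * norm \<xi>)" if "\<xi> \<in> dual_cone \<Omega>" for \<xi>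
    proof -
      have "(cmod (kernel_symbol w \<xi>))\<^sup>2 * weight \<xi> = (cmod (exp (\<i> * bilin w \<xi>)))\<^sup>2 / weight \<xi>"
        using weight_pos[of \<xi>]
        by (simp add: kernel_symbol_def norm_divide power_divide power2_eq_square del: norm_exp_eq_Re)
      also have "\<dots> \<le> (cmod (exp (\<i> * bilin w \<xi>)))\<^sup>2 / 1"
        using sobolev_weight_ge_1 by (intro divide_left_mono) (auto simp: weight_pos)
      also have "\<dots> \<le> (exp (- c * norm \<xi>))\<^sup>2"
        using c(2)[OF that] by (simp only: div_by_1) (rule power_mono, auto)
      also have "\<dots> = exp (- (2 * c) * norm \<xi>)" by (simp add: exp_double[symmetric])
      finally show ?thesis .
    qed
    then show "AE \<xi> in M. norm ((cmod (kernel_symbol w \<xi>))\<^sup>2 * weight \<xi>) \<le> norm (exp (- (2 * c) * norm \<xi>))"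
      using weight_pos by (intro AE_I2) auto
  qed measurable
  then show ?thesis by (simp add: weighted_L2_def)
qed

definition kernel_fun :: "complex ^ 'd \<Rightarrow> complex ^ 'd \<Rightarrow> complex" where
  "kernel_fun w = laplace \<Omega> (kernel_symbol w)"

lemma kernel_fun_in_H: "w \<in> tube \<Omega> \<Longrightarrow> kernel_fun w \<in> H"
  by (simp add: kernel_fun_def kernel_symbol_L2 laplace_in_H)

text \<open>
  The weight in the inner product cancels the denominator of the symbol and leaves the integral that
  defines the transform at \<open>w\<close>.
\<close>

lemma kernel_fun_reproducing:
  assumes F: "F \<in> H" and w: "w \<in> tube \<Omega>"
  shows "F w = inner2 F (kernel_fun w)"
proof -
  define f where "f = inv_laplace \<Omega> \<rho> n F"
  have f: "f \<in> L2" "F = laplace \<Omega> f" using H_E[OF F] by (simp_all add: f_def)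
  have "f \<xi> * cnj (kernel_symbol w \<xi>) * complex_of_real (weight \<xi>) = exp (\<i> * bilin w \<xi>) * f \<xi>" for \<xi>
    using weight_pos[of \<xi>] by (simp add: kernel_symbol_def)
  then have "inner2 F (kernel_fun w) = (\<integral>\<xi>. exp (\<i> * bilin w \<xi>) * f \<xi> \<partial>M)"
    by (simp only: f(2) kernel_fun_def inner2_laplace[OF f(1) kernel_symbol_L2[OF w]])
  then show ?thesis using w by (simp add: f(2) laplace_def)
qed

text \<open>
  If \<open>k\<close> reproduces at \<open>w\<close> as well, then
  \<open>k(z) = \<langle>k, k\<^sub>z\<rangle> = \<langle>k\<^sub>z, k\<rangle>\<^sup>* = k\<^sub>z(w)\<^sup>* = \<langle>k\<^sub>z, k\<^sub>w\<rangle>\<^sup>* = \<langle>k\<^sub>w, k\<^sub>z\<rangle> = k\<^sub>w(z)\<close>, the star being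
  conjugation. Outside the tube domain both functions are undefined.
\<close>

lemma hs_kernel_eq_kernel_fun:
  assumes w: "w \<in> tube \<Omega>"
  shows "hs_kernel \<Omega> \<rho> n z w = kernel_fun w z"
proof -
  have "(THE k. k \<in> H \<and> (\<forall>F\<in>H. F w = inner2 F k)) = kernel_fun w"
  proof (rule the_equality)
    fix k assume k: "k \<in> H \<and> (\<forall>F\<in>H. F w = inner2 F k)"
    show "k = kernel_fun w"
    proof
      fix z
      show "k z = kernel_fun w z"
      proof (cases "z \<in> tube \<Omega>")
        case True
        have "k z = cnj (inner2 (kernel_fun z) k)"
          using k True by (simp add: inner2_cnj kernel_fun_reproducing)
        also have "inner2 (kernel_fun z) k = kernel_fun z w"
          using k True by (simp add: kernel_fun_in_H)
        also have "\<dots> = inner2 (kernel_fun z) (kernel_fun w)"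
          using True w by (intro kernel_fun_reproducing kernel_fun_in_H)
        also have "cnj \<dots> = kernel_fun w z"
          unfolding inner2_cnj using True w by (intro kernel_fun_reproducing[symmetric] kernel_fun_in_H)
        finally show ?thesis .
      next
        case False
        then have undef: "laplace \<Omega> f z = undefined" for f by (simp add: laplace_def)
        have "k = laplace \<Omega> (inv_laplace \<Omega> \<rho> n k)" using k H_E(2) by blast
        from fun_cong[OF this, of z] have "k z = undefined" by (simp add: undef)
        then show ?thesis by (simp add: kernel_fun_def undef)
      qed
    qed
  qed (use w kernel_fun_in_H kernel_fun_reproducing in blast)
  then show ?thesis by (simp add: hs_kernel_def)
qed

lemma hs_kernel_diagonal:
  "w \<in> tube \<Omega> \<Longrightarrow> hs_kernel \<Omega> \<rho> n w w = complex_of_real ((norm2 (kernel_fun w))\<^sup>2)"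
  by (simp add: hs_kernel_eq_kernel_fun kernel_fun_reproducing[of "kernel_fun w"] kernel_fun_in_H inner2_self_norm)

section \<open>Weighted composition operators\<close>

text \<open>
  The operator norm is a supremum over the unit ball, so \<open>F\<close> is rescaled to norm one; a function of norm
  zero is handled by any bound \<open>C\<close> of the operator.
\<close>

lemma norm2_le_onorm:
  assumes A: "hs_bounded_op \<Omega> \<rho> n A" and F: "F \<in> H"
    and hom: "\<And>c. A (\<lambda>z\<in>tube \<Omega>. c * F z) = (\<lambda>z\<in>tube \<Omega>. c * A F z)"
  shows "norm2 (A F) \<le> hs_onorm \<Omega> \<rho> n A * norm2 F"
proof -
  obtain C where C: "\<And>F. F \<in> H \<Longrightarrow> norm2 (A F) \<le> C * norm2 F" and AF: "A F \<in> H"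
    using A F by (auto simp: hs_bounded_op_def)
  show ?thesis
  proof (cases "norm2 F = 0")
    case True
    then show ?thesis using C[OF F] by simp
  next
    case False
    then have pos: "0 < norm2 F" using norm2_nonneg[of F] by simp
    define c where "c = complex_of_real (1 / norm2 F)"
    define G where "G = (\<lambda>z\<in>tube \<Omega>. c * F z)"
    have G: "G \<in> H" "norm2 G = 1" using H_scale[OF F, of c] pos by (simp_all add: G_def c_def norm_divide)
    have "norm2 (A F) / norm2 F = norm2 (A G)"
      unfolding G_def hom using H_scale(2)[OF AF, of c] pos by (simp add: c_def norm_divide)
    also have "\<dots> \<le> hs_onorm \<Omega> \<rho> n A"
      unfolding hs_onorm_def
    proof (rule cSup_upper)
      show "norm2 (A G) \<in> {norm2 (A F) |F. F \<in> H \<and> norm2 F \<le> 1}" using G by auto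
      show "bdd_above {norm2 (A F) |F. F \<in> H \<and> norm2 F \<le> 1}"
      proof (rule bdd_aboveI)
        fix x assume "x \<in> {norm2 (A F) |F. F \<in> H \<and> norm2 F \<le> 1}"
        then obtain F where "x = norm2 (A F)" and F: "F \<in> H" "norm2 F \<le> 1" by blast
        then have "x \<le> C * norm2 F" using C by simp
        also have "\<dots> \<le> \<bar>C\<bar> * 1" using F norm2_nonneg by (intro mult_mono) auto
        finally show "x \<le> \<bar>C\<bar>" by simp
      qed
    qed
    finally show ?thesis using pos by (simp add: field_simps)
  qed
qed

end

theorem corollary8p5:
  fixes \<Omega> :: "(real ^ 'd) set"
    and \<rho> :: "real ^ 'd \<Rightarrow> real"
    and n :: nat
    and \<phi> :: "complex ^ 'd \<Rightarrow> complex ^ 'd"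
    and \<psi> :: "complex ^ 'd \<Rightarrow> complex"
    and w :: "complex ^ 'd"
  assumes "\<Omega> \<noteq> {}" and "open_convex_cone \<Omega>" and "\<not> contains_line \<Omega>"
    and "continuous_on (dual_cone \<Omega>) \<rho>"
    and "\<And>\<xi>. \<xi> \<in> dual_cone \<Omega> \<Longrightarrow> \<rho> \<xi> \<ge> 0"
    and "\<And>\<xi>. \<xi> \<in> dual_cone \<Omega> \<Longrightarrow> \<xi> \<noteq> 0 \<Longrightarrow> \<rho> \<xi> > 0"
    and "\<And>t \<xi>. t > 0 \<Longrightarrow> \<xi> \<in> dual_cone \<Omega> \<Longrightarrow> \<rho> (t *\<^sub>R \<xi>) = t * \<rho> \<xi>"
    and "\<phi> \<in> tube \<Omega> \<rightarrow> tube \<Omega>" and "\<And>j. holomorphic_cn_on (\<lambda>z. \<phi> z $ j) (tube \<Omega>)"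
    and "holomorphic_cn_on \<psi> (tube \<Omega>)"
    and "hs_bounded_op \<Omega> \<rho> n (weighted_comp \<Omega> \<psi> \<phi>)"
    and "w \<in> tube \<Omega>"
  shows "complex_of_real ((cmod (\<psi> w))\<^sup>2) * hs_kernel \<Omega> \<rho> n (\<phi> w) (\<phi> w)
           \<le> complex_of_real ((hs_onorm \<Omega> \<rho> n (weighted_comp \<Omega> \<psi> \<phi>))\<^sup>2) * hs_kernel \<Omega> \<rho> n w w"
proof -
  interpret hardy_sobolev_tube \<Omega> \<rho> n
    using assms by unfold_locales
  let ?W = "weighted_comp \<Omega> \<psi> \<phi>"
  let ?N = "hs_onorm \<Omega> \<rho> n ?W"
  define a where "a = norm2 (kernel_fun (\<phi> w))"
  define b where "b = norm2 (kernel_fun w)"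
  have w: "w \<in> tube \<Omega>" and \<phi>w: "\<phi> w \<in> tube \<Omega>" using assms by auto
  let ?k = "kernel_fun (\<phi> w)"
  have k: "?k \<in> H" using \<phi>w by (rule kernel_fun_in_H)
  have Wk: "?W ?k \<in> H" using assms(11) k by (simp add: hs_bounded_op_def)
  have "?W (\<lambda>z\<in>tube \<Omega>. c * ?k z) = (\<lambda>z\<in>tube \<Omega>. c * ?W ?k z)" for c
    using assms(8) by (auto simp: weighted_comp_def fun_eq_iff)
  then have Wnorm: "norm2 (?W ?k) \<le> ?N * a"
    unfolding a_def by (intro norm2_le_onorm assms(11) k)
  have "?k (\<phi> w) = complex_of_real (a\<^sup>2)"
    using hs_kernel_diagonal[OF \<phi>w] by (simp add: a_def hs_kernel_eq_kernel_fun[OF \<phi>w])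
  then have "cmod (\<psi> w) * a\<^sup>2 = cmod (?W ?k w)"
    using w by (simp add: weighted_comp_def norm_mult norm_power a_def norm2_nonneg)
  also have "\<dots> = cmod (inner2 (?W ?k) (kernel_fun w))"
    using kernel_fun_reproducing[OF Wk w] by simp
  also have "\<dots> \<le> norm2 (?W ?k) * b"
    unfolding b_def using w by (intro inner2_Cauchy_Schwarz Wk kernel_fun_in_H)
  also have "\<dots> \<le> ?N * a * b"
    using Wnorm by (intro mult_right_mono) (auto simp: b_def norm2_nonneg)
  finally have main: "cmod (\<psi> w) * a\<^sup>2 \<le> ?N * a * b" .
  have "(cmod (\<psi> w))\<^sup>2 * a\<^sup>2 \<le> ?N\<^sup>2 * b\<^sup>2"
  proof (cases "a = 0")
    case False
    then have "0 < a" using norm2_nonneg[of ?k] by (simp add: a_def)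
    then have "cmod (\<psi> w) * a \<le> ?N * b"
      using main by (simp add: power2_eq_square mult_ac)
    then have "(cmod (\<psi> w) * a)\<^sup>2 \<le> (?N * b)\<^sup>2"
      using \<open>0 < a\<close> by (intro power_mono) auto
    then show ?thesis by (simp add: power_mult_distrib)
  qed simp
  then have "complex_of_real ((cmod (\<psi> w))\<^sup>2 * a\<^sup>2) \<le> complex_of_real (?N\<^sup>2 * b\<^sup>2)"
    by (simp add: less_eq_complex_def del: of_real_mult of_real_power)
  then show ?thesis
    by (simp only: hs_kernel_diagonal[OF \<phi>w] hs_kernel_diagonal[OF w] a_def b_def of_real_mult)
qed

end
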